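(* Let $\mathbb{B}=(\mathbb{B}_\alpha,\|\cdot\|_\alpha)$ and $\mathbb{E}=(\mathbb{E}_\alpha,|||\cdot|||_\alpha)$, $\alpha\in[\alpha_*,\alpha^*]$, be two scales of Banach spaces with $\mathbb{B}_\alpha\subset\mathbb{E}_\alpha$ continuously embedded and $|||\cdot|||_\alpha\le\|\cdot\|_\alpha$ for all $\alpha$. Let $T>0$, $x\in\mathbb{B}_{\alpha_*}$, and suppose that conditions A1, A2, A3, A4, B1, B2, B3 (listed in the context) are satisfied, where either ($\beta=0$ and $r\in(0,\infty]$) or ($\beta\in(0,\tfrac12)$ and $r=\infty$). Let $\alpha_0\in(\alpha_*,\alpha^* )$, $\gamma\in(\beta,1-\beta)$ and $\lambda>\lambda_0(x,\alpha_0,\gamma,r,T)$. Let $u=u_{\alpha_0,\lambda,\gamma}$ be the solution to $$u(t)=U(t,0)x+\int_0^tU(t,s)B(u(s),s)\,\mathrm{d}s$$ on $[0,\frac{\alpha^*-\alpha_0}{\lambda})$ in the scale $(\mathbb{B}_\alpha)_{\alpha\in[\alpha_0,\alpha^*]}$ with $$\sup_{\alpha\in(\alpha_0,\alpha^*]}\ \sup_{0\le t<\frac{\alpha-\alpha_0}{\lambda}}(\alpha-\alpha_0-\lambda t)^\gamma\|u(t)\|_\alpha<\infty .$$ Then $u$ is also a classical $\mathbb{B}$-valued solution, on the interval $[0,\frac{\alpha^*-\alpha_0}{\lambda})$, to $$\frac{\mathrm{d}u(t)}{\mathrm{d}t}=A(t)u(t)+B(u(t),t),\qquad u(0)=x 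.$$
   Context: Scale: $\mathbb{B}=(\mathbb{B}_\alpha,\|\cdot\|_\alpha)_{\alpha_*\le\alpha\le\alpha^*}$ are Banach spaces with $\mathbb{B}_{\alpha'}\subset\mathbb{B}_\alpha$ and $\|\cdot\|_\alpha\le\|\cdot\|_{\alpha'}$ for $\alpha'<\alpha$; $i_{\alpha'\alpha}$ is the embedding. $B_r^\alpha(x)=\{y\in\mathbb{B}_\alpha:\|y-x\|_\alpha\le r\}$ for $r\in(0,\infty)$, $B_\infty^\alpha(x)=\mathbb{B}_\alpha$. A nonlinear operator $L$ in the scale (relative to $r\in(0,\infty]$ and $x\in\mathbb{B}_{\alpha_*}$) is a collection of maps $L_{\alpha'\alpha}:B_r^{\alpha'}(x)\to\mathbb{B}_\alpha$, $\alpha_*\le\alpha'<\alpha\le\alpha^*$, with $L_{\alpha'\alpha''}y=i_{\alpha\alpha''}L_{\alpha'\alpha}y=L_{\alpha\alpha''}i_{\alpha'\alpha}y$ for $\alpha'<\alpha<\alpha''$ and $y\in B_r^{\alpha'}(x)$. It is a bounded linear operator in the scale if $r=\infty$ and every $L_{\alpha'\alpha}$ is a bounded linear operator $\mathbb{B}_{\alpha'}\to\mathbb{B}_\alpha$. Compositions are $(LK)_{\alpha'\alpha}=L_{\delta\alpha}K_{\alpha'\delta}$ for any $\delta\in(\alpha',\alpha)$ (independent of $\delta$). Subscripts are omitted; $\|\cdot\|_{\alpha'\alpha}$ is the operator norm in $L(\mathbb{B}_{\alpha'},\mathbb{B}_\alpha)$. Conditions ($x\in\mathbb{B}_{\alpha_*}$,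 $T>0$ fixed): A1. $(U(t,s))_{0\le s\le t<T}$ are bounded linear operators in the scale with $U(t,t)=1$ (the embedding), $U(t,q)U(q,s)=U(t,s)$ for $s\le q\le t$, and $(t,s)\mapsto U(t,s)\in L(\mathbb{B}_{\alpha'},\mathbb{B}_\alpha)$ strongly continuous for all $\alpha'<\alpha$. A2. There are $C_1>0$, $\beta\in[0,\frac12)$ with $\|U(t,s)\|_{\alpha'\alpha}\le\frac{C_1}{(\alpha-\alpha')^\beta}$ for all $\alpha'<\alpha$, $0\le s\le t<T$. A3. For each $\alpha\in(\alpha_*,\alpha^*]$ there is $C(x,\alpha)>0$ with $\|U(t,0)x-U(s,0)x\|_\alpha\le C(x,\alpha)|t-s|$ for $0\le s,t\le\frac{\alpha-\alpha_*}{\alpha^*-\alpha_*}T$. A4. There is a family of linear operators $(A(t))_{t\in[0,T)}$ (compatible with the embeddings of the scales) such that for all $\alpha'<\alpha$ the map $[0,T)\ni t\mapsto A(t)\in L(\mathbb{B}_{\alpha'},\mathbb{E}_\alpha)$ is strongly continuous. The $U(t,s)$ also act as bounded linear operators in the scale $\mathbb{E}$ (extending those on $\mathbb{B}$), and $(t,s)\mapsto U(t,s)y\in\mathbb{E}_\alpha$ is continuous for any $y\in\mathbb{E}_{\alpha'}$ and $\alpha'<\alpha$. Moreover, for $y\in\mathbb{B}_{\alpha'}$ and $\alpha'<\alpha$ the function $(t,s)\mapsto U(t,s)y$ is differentiable in $\mathbb{E}_\alpha$ with $\frac{\partial U(t,s)}{\partial t}y=A(t)U(t,s)y$ and $\frac{\partial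 U(t,s)}{\partial s}y=-U(t,s)A(s)y$ for $0\le s\le t<T$ (one-sided derivatives when $s=t$). B1. For some $r\in(0,\infty]$, $(B(\cdot,t))_{t\in[0,T)}$ is a family of nonlinear operators in the scale (relative to $r$, $x$) such that $B_r^{\alpha'}(x)\times[0,T)\ni(u,t)\mapsto B(u,t)\in\mathbb{B}_\alpha$ is jointly continuous for all $\alpha'<\alpha$. B2. There is $C_2>0$ with $\|B(u,t)-B(v,t)\|_\alpha\le\frac{C_2}{(\alpha-\alpha')^{1-\beta}}\|u-v\|_{\alpha'}$ for all $\alpha'<\alpha$, $t\in[0,T)$, $u,v\in B_r^{\alpha'}(x)$ (same $\beta$ as in A2). B3. There is $C_3>0$ with $\|B(x,t)\|_\alpha\le\frac{C_3}{\alpha-\alpha_*}$ for all $t\in[0,T)$, $\alpha\in(\alpha_*,\alpha^*]$. Constant $\lambda_0$: for $\alpha_0\in(\alpha_*,\alpha^* )$, $\gamma\in(\beta,1-\beta)$, $r'\in(0,r]$ and with $C(x)=C(x,\alpha_0)$ and $1/\infty:=0$, $\lambda_0(x,\alpha_0,\gamma,r',T)$ is the maximum of the four numbers $$\frac{\alpha^*-\alpha_*}{T},\quad \frac{2^{2\gamma+1-\beta}C_1C_2}{\gamma-\beta},\quad \frac{4^{1-\beta}C_2(\alpha^*-\alpha_0)^\beta}{\gamma(1+\|x\|_{\alpha_*})}+\frac{2^{2+\gamma}C_1C_2}{\gamma},$$ $$\frac{C(x)(\alpha^*-\alpha_0)}{r'}+\frac{C_1\big(\frac{C_3}{\alpha_0-\alpha_*}+C(x)\big)(\alpha^*-\alpha_0)(1+\|x\|_{\alpha_*})}{(1-\gamma)r'}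 .$$ Solution of the integral equation: for $\alpha_0\in[\alpha_*,\alpha^* )$ and $\lambda>0$ with $\frac{\alpha^*-\alpha_0}{\lambda}\le T$, put $T(\alpha)=\frac{\alpha-\alpha_0}{\lambda}$. A solution on $[0,\frac{\alpha^*-\alpha_0}{\lambda})$ in the scale $(\mathbb{B}_\alpha)_{\alpha\in[\alpha_0,\alpha^*]}$ is a function $u:[0,T(\alpha^* ))\to\mathbb{B}_{\alpha^*}$ such that for all $\alpha\in(\alpha_0,\alpha^*]$: (i) $u|_{[0,T(\alpha))}\in C([0,T(\alpha));\mathbb{B}_\alpha)$ and $u(t)\in B_r^\alpha(x)$ for $t\in[0,T(\alpha))$; (ii) for each $t\in[0,T(\alpha))$ there are $\alpha'<\alpha''$ in $[\alpha_0,\alpha)$ with $t<T(\alpha')$ such that $u(t)=U_{\alpha_*\alpha}(t,0)x+\int_0^tU_{\alpha''\alpha}(t,s)B_{\alpha'\alpha''}(u(s),s)\,\mathrm{d}s$ in $\mathbb{B}_\alpha$ (independent of the choice of $\alpha',\alpha''$). Under the hypotheses of the claim a solution with the stated weighted bound exists and is unique. Classical $\mathbb{B}$-valued solution on $[0,\frac{\alpha^*-\alpha_0}{\lambda})$: a function $u:[0,T(\alpha^* ))\to\mathbb{B}_{\alpha^*}$ such that for all $\alpha\in(\alpha_0,\alpha^*]$ the restriction $u|_{[0,T(\alpha))}$ lies in $C^1([0,T(\alpha));\mathbb{E}_\alpha)\cap C([0,T(\alpha));\mathbb{B}_\alpha)$, $u(t)\in B_r^\alpha(x)$ for all $t\in[0,T(\alpha))$,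 $u(0)=x$, and $\frac{\mathrm{d}u(t)}{\mathrm{d}t}=A(t)u(t)+B(u(t),t)$ holds in $\mathbb{E}_\alpha$ for all $t\in[0,T(\alpha))$ (here $u(t)\in\mathbb{B}_{\alpha'}$ for some $\alpha'<\alpha$ with $t<T(\alpha')$, so the right-hand side is in $\mathbb{E}_\alpha$). *)

theory Defs
  imports "HOL-Analysis.Analysis"
begin

section \<open>Normed spaces inside an ambient vector space\<close>

text \<open>
  All spaces of the two scales are linear subspaces of one ambient real vector space (the largest
  space of the scale \<open>E\<close> can serve as such), each with its own norm, so the embeddings are
  inclusions. The function \<open>nrm X\<close> is only meaningful on \<open>pts X\<close>.
\<close>

record 'a nspace =
  pts :: "'a set"
  nrm :: "'a \<Rightarrow> real"

text \<open>The value \<open>0\<close> off the carrier is forced by the axioms of \<open>Metric_space\<close>, which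
  require non-negativity and symmetry everywhere.\<close>

definition ndist :: "'a::real_vector nspace \<Rightarrow> 'a \<Rightarrow> 'a \<Rightarrow> real" where
  "ndist X u v = (if u \<in> pts X \<and> v \<in> pts X then nrm X (u - v) else 0)"

abbreviation ntop :: "'a::real_vector nspace \<Rightarrow> 'a topology" where
  "ntop X \<equiv> Metric_space.mtopology (pts X) (ndist X)"

definition normed_space :: "'a::real_vector nspace \<Rightarrow> bool" where
  "normed_space X \<longleftrightarrow>
     subspace (pts X) \<and>
     (\<forall>v\<in>pts X. 0 \<le> nrm X v \<and> (nrm X v = 0 \<longleftrightarrow> v = 0)) \<and>
     (\<forall>c. \<forall>v\<in>pts X. nrm X (c *\<^sub>R v) = \<bar>c\<bar> * nrm X v) \<and>
     (\<forall>v\<in>pts X. \<forall>w\<in>pts X. nrm X (v + w) \<le> nrm X v + nrm X w)"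

definition banach_space :: "'a::real_vector nspace \<Rightarrow> bool" where
  "banach_space X \<longleftrightarrow> normed_space X \<and> Metric_space.mcomplete (pts X) (ndist X)"

lemma Metric_space_ndist:
  assumes "normed_space X"
  shows "Metric_space (pts X) (ndist X)"
proof -
  have sub: "subspace (pts X)"
    and pos: "\<And>v. v \<in> pts X \<Longrightarrow> 0 \<le> nrm X v"
    and zero: "\<And>v. v \<in> pts X \<Longrightarrow> nrm X v = 0 \<longleftrightarrow> v = 0"
    and scale: "\<And>c v. v \<in> pts X \<Longrightarrow> nrm X (c *\<^sub>R v) = \<bar>c\<bar> * nrm X v"
    and tri: "\<And>v w. v \<in> pts X \<Longrightarrow> w \<in> pts X \<Longrightarrow> nrm X (v + w) \<le> nrm X v + nrm X w"
    using assms unfolding normed_space_def by blast+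
  have diff: "u - v \<in> pts X" if "u \<in> pts X" "v \<in> pts X" for u v
    using sub that by (rule subspace_diff)
  show ?thesis
  proof
    show "0 \<le> ndist X u v" for u v
      by (simp add: ndist_def pos diff)
    show "ndist X u v = ndist X v u" for u v
      using scale[of "u - v" "- 1"] by (simp add: ndist_def diff)
    show "ndist X u v = 0 \<longleftrightarrow> u = v" if "u \<in> pts X" "v \<in> pts X" for u v
      using that by (simp add: ndist_def zero diff)
    show "ndist X u w \<le> ndist X u v + ndist X v w"
      if "u \<in> pts X" "v \<in> pts X" "w \<in> pts X" for u v w
      using that tri[of "u - v" "v - w"] by (simp add: ndist_def diff)
  qed
qed

definition bounded_linear_between ::
    "'a::real_vector nspace \<Rightarrow> 'a nspace \<Rightarrow> ('a \<Rightarrow> 'a) \<Rightarrow> bool" where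
  "bounded_linear_between X Y f \<longleftrightarrow>
     f ` pts X \<subseteq> pts Y \<and>
     (\<forall>v\<in>pts X. \<forall>w\<in>pts X. f (v + w) = f v + f w) \<and>
     (\<forall>c. \<forall>v\<in>pts X. f (c *\<^sub>R v) = c *\<^sub>R f v) \<and>
     (\<exists>K. \<forall>v\<in>pts X. nrm Y (f v) \<le> K * nrm X v)"

text \<open>As in \<open>onorm\<close>, the quotient at \<open>v = 0\<close> is \<open>0\<close>.\<close>

definition opnorm :: "'a::real_vector nspace \<Rightarrow> 'a nspace \<Rightarrow> ('a \<Rightarrow> 'a) \<Rightarrow> real" where
  "opnorm X Y f = (SUP v\<in>pts X. nrm Y (f v) / nrm X v)"

text \<open>Differentiation with respect to a real variable in the norm of \<open>X\<close>, relative to a set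
  \<open>S\<close> of parameters; one-sided at end points of an interval \<open>S\<close>, and no condition at an isolated
  point of \<open>S\<close>.\<close>

definition has_nderiv ::
    "'a::real_vector nspace \<Rightarrow> (real \<Rightarrow> 'a) \<Rightarrow> 'a \<Rightarrow> real \<Rightarrow> real set \<Rightarrow> bool" where
  "has_nderiv X f d t S \<longleftrightarrow> limitin (ntop X) (\<lambda>h. (1 / (h - t)) *\<^sub>R (f h - f t)) d (at t within S)"

text \<open>Riemann integral in the norm of \<open>X\<close>: as \<open>has_integral\<close>, but with gauges of constant radius.\<close>

definition has_nintegral ::
    "'a::real_vector nspace \<Rightarrow> (real \<Rightarrow> 'a) \<Rightarrow> 'a \<Rightarrow> real \<Rightarrow> real \<Rightarrow> bool" where
  "has_nintegral X f I a b \<longleftrightarrow>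
     I \<in> pts X \<and> f ` {a..b} \<subseteq> pts X \<and>
     (\<forall>\<epsilon>>0. \<exists>\<delta>>0. \<forall>p. p tagged_division_of {a..b} \<and> (\<lambda>s. ball s \<delta>) fine p \<longrightarrow>
        nrm X ((\<Sum>(s, k)\<in>p. Henstock_Kurzweil_Integration.content k *\<^sub>R f s) - I) < \<epsilon>)"

section \<open>Scales of Banach spaces and operators in scales\<close>

text \<open>The index interval is \<open>{al..au}\<close>; only the values of a scale on this interval matter.\<close>

definition banach_scale :: "real \<Rightarrow> real \<Rightarrow> (real \<Rightarrow> 'a::real_vector nspace) \<Rightarrow> bool" where
  "banach_scale al au X \<longleftrightarrow>
     (\<forall>\<alpha>\<in>{al..au}. banach_space (X \<alpha>)) \<and>
     (\<forall>\<alpha>' \<alpha>. al \<le> \<alpha>' \<and> \<alpha>' < \<alpha> \<and> \<alpha> \<le> au \<longrightarrow>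
        pts (X \<alpha>') \<subseteq> pts (X \<alpha>) \<and> (\<forall>v\<in>pts (X \<alpha>'). nrm (X \<alpha>) v \<le> nrm (X \<alpha>') v))"

definition scale_embedded ::
    "real \<Rightarrow> real \<Rightarrow> (real \<Rightarrow> 'a::real_vector nspace) \<Rightarrow> (real \<Rightarrow> 'a nspace) \<Rightarrow> bool" where
  "scale_embedded al au X Y \<longleftrightarrow>
     (\<forall>\<alpha>\<in>{al..au}. pts (X \<alpha>) \<subseteq> pts (Y \<alpha>) \<and> (\<forall>v\<in>pts (X \<alpha>). nrm (Y \<alpha>) v \<le> nrm (X \<alpha>) v))"

definition sball :: "(real \<Rightarrow> 'a::real_vector nspace) \<Rightarrow> ereal \<Rightarrow> 'a \<Rightarrow> real \<Rightarrow> 'a set" where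
  "sball X r x \<alpha> = {y \<in> pts (X \<alpha>). ereal (nrm (X \<alpha>) (y - x)) \<le> r}"

text \<open>An operator in a scale is a family \<open>L \<alpha>' \<alpha>\<close> of maps defined on sets \<open>D \<alpha>'\<close>. The embeddings
  being inclusions, they are not written in the compatibility condition.\<close>

definition scale_operator ::
    "real \<Rightarrow> real \<Rightarrow> (real \<Rightarrow> 'a::real_vector set) \<Rightarrow> (real \<Rightarrow> 'a nspace)
      \<Rightarrow> (real \<Rightarrow> real \<Rightarrow> 'a \<Rightarrow> 'a) \<Rightarrow> bool" where
  "scale_operator al au D Y L \<longleftrightarrow>
     (\<forall>\<alpha>' \<alpha>. al \<le> \<alpha>' \<and> \<alpha>' < \<alpha> \<and> \<alpha> \<le> au \<longrightarrow> L \<alpha>' \<alpha> ` D \<alpha>' \<subseteq> pts (Y \<alpha>)) \<and>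
     (\<forall>\<alpha>' \<alpha> \<alpha>''. al \<le> \<alpha>' \<and> \<alpha>' < \<alpha> \<and> \<alpha> < \<alpha>'' \<and> \<alpha>'' \<le> au \<longrightarrow>
        (\<forall>y\<in>D \<alpha>'. L \<alpha>' \<alpha>'' y = L \<alpha>' \<alpha> y \<and> L \<alpha>' \<alpha> y = L \<alpha> \<alpha>'' y))"

definition nonlinear_operator ::
    "real \<Rightarrow> real \<Rightarrow> (real \<Rightarrow> 'a::real_vector nspace) \<Rightarrow> ereal \<Rightarrow> 'a
      \<Rightarrow> (real \<Rightarrow> real \<Rightarrow> 'a \<Rightarrow> 'a) \<Rightarrow> bool" where
  "nonlinear_operator al au X r x L \<longleftrightarrow> scale_operator al au (sball X r x) X L"

text \<open>Bounded linear operators from a scale \<open>X\<close> to a scale \<open>Y\<close>. For \<open>Y = X\<close> this is a nonlinear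
  operator with radius \<open>\<infinity>\<close> all of whose members are bounded and linear.\<close>

definition bounded_linear_operator ::
    "real \<Rightarrow> real \<Rightarrow> (real \<Rightarrow> 'a::real_vector nspace) \<Rightarrow> (real \<Rightarrow> 'a nspace)
      \<Rightarrow> (real \<Rightarrow> real \<Rightarrow> 'a \<Rightarrow> 'a) \<Rightarrow> bool" where
  "bounded_linear_operator al au X Y L \<longleftrightarrow>
     scale_operator al au (\<lambda>\<alpha>. pts (X \<alpha>)) Y L \<and>
     (\<forall>\<alpha>' \<alpha>. al \<le> \<alpha>' \<and> \<alpha>' < \<alpha> \<and> \<alpha> \<le> au \<longrightarrow> bounded_linear_between (X \<alpha>') (Y \<alpha>) (L \<alpha>' \<alpha>))"

lemma sball_infinity: "sball X \<infinity> x \<alpha> = pts (X \<alpha>)"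
  by (simp add: sball_def)

lemma bounded_linear_operator_imp_nonlinear:
  "bounded_linear_operator al au X X L \<Longrightarrow> nonlinear_operator al au X \<infinity> x L"
  by (simp add: bounded_linear_operator_def nonlinear_operator_def sball_infinity[abs_def])

section \<open>The conditions on the equation\<close>

text \<open>
  \<open>U t s \<alpha>' \<alpha>\<close>, \<open>A t \<alpha>' \<alpha>\<close> and \<open>B t \<alpha>' \<alpha>\<close> are the members from index \<open>\<alpha>'\<close> to index \<open>\<alpha>\<close> of
  \<open>U(t,s)\<close>, \<open>A(t)\<close> and \<open>B(\<cdot>,t)\<close>. Compositions are required to be as stated for every intermediate
  index \<open>\<delta>\<close>; by compatibility their value does not depend on \<open>\<delta>\<close>.
\<close>

abbreviation time_triangle :: "real \<Rightarrow> (real \<times> real) set" where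
  "time_triangle T \<equiv> {(t, s). 0 \<le> s \<and> s \<le> t \<and> t < T}"

definition cond_A1 ::
    "real \<Rightarrow> real \<Rightarrow> (real \<Rightarrow> 'a::real_vector nspace) \<Rightarrow> real
      \<Rightarrow> (real \<Rightarrow> real \<Rightarrow> real \<Rightarrow> real \<Rightarrow> 'a \<Rightarrow> 'a) \<Rightarrow> bool" where
  "cond_A1 al au X T U \<longleftrightarrow>
     (\<forall>t s. 0 \<le> s \<and> s \<le> t \<and> t < T \<longrightarrow> bounded_linear_operator al au X X (U t s)) \<and>
     (\<forall>\<alpha>' \<alpha>. al \<le> \<alpha>' \<and> \<alpha>' < \<alpha> \<and> \<alpha> \<le> au \<longrightarrow>
        (\<forall>t. 0 \<le> t \<and> t < T \<longrightarrow> (\<forall>y\<in>pts (X \<alpha>'). U t t \<alpha>' \<alpha> y = y)) \<and>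
        (\<forall>t q s \<delta>. 0 \<le> s \<and> s \<le> q \<and> q \<le> t \<and> t < T \<and> \<alpha>' < \<delta> \<and> \<delta> < \<alpha> \<longrightarrow>
           (\<forall>y\<in>pts (X \<alpha>'). U t q \<delta> \<alpha> (U q s \<alpha>' \<delta> y) = U t s \<alpha>' \<alpha> y)) \<and>
        (\<forall>y\<in>pts (X \<alpha>'). continuous_map (top_of_set (time_triangle T)) (ntop (X \<alpha>))
           (\<lambda>(t, s). U t s \<alpha>' \<alpha> y)))"

definition cond_A2 ::
    "real \<Rightarrow> real \<Rightarrow> (real \<Rightarrow> 'a::real_vector nspace) \<Rightarrow> real
      \<Rightarrow> (real \<Rightarrow> real \<Rightarrow> real \<Rightarrow> real \<Rightarrow> 'a \<Rightarrow> 'a) \<Rightarrow> real \<Rightarrow> real \<Rightarrow> bool" where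
  "cond_A2 al au X T U C1 \<beta> \<longleftrightarrow>
     0 < C1 \<and> 0 \<le> \<beta> \<and> \<beta> < 1/2 \<and>
     (\<forall>\<alpha>' \<alpha> t s. al \<le> \<alpha>' \<and> \<alpha>' < \<alpha> \<and> \<alpha> \<le> au \<and> 0 \<le> s \<and> s \<le> t \<and> t < T \<longrightarrow>
        opnorm (X \<alpha>') (X \<alpha>) (U t s \<alpha>' \<alpha>) \<le> C1 / (\<alpha> - \<alpha>') powr \<beta>)"

text \<open>For \<open>\<alpha> = au\<close> the bound on \<open>s\<close> and \<open>t\<close> is \<open>T\<close>, where \<open>U\<close> is not defined; hence the additional
  restrictions \<open>s < T\<close> and \<open>t < T\<close>.\<close>

definition cond_A3 ::
    "real \<Rightarrow> real \<Rightarrow> (real \<Rightarrow> 'a::real_vector nspace) \<Rightarrow> real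
      \<Rightarrow> (real \<Rightarrow> real \<Rightarrow> real \<Rightarrow> real \<Rightarrow> 'a \<Rightarrow> 'a) \<Rightarrow> 'a \<Rightarrow> (real \<Rightarrow> real) \<Rightarrow> bool" where
  "cond_A3 al au X T U x C \<longleftrightarrow>
     (\<forall>\<alpha>. al < \<alpha> \<and> \<alpha> \<le> au \<longrightarrow>
        0 < C \<alpha> \<and>
        (\<forall>t s. 0 \<le> s \<and> s \<le> (\<alpha> - al) / (au - al) * T \<and> s < T \<and>
               0 \<le> t \<and> t \<le> (\<alpha> - al) / (au - al) * T \<and> t < T \<longrightarrow>
           nrm (X \<alpha>) (U t 0 al \<alpha> x - U s 0 al \<alpha> x) \<le> C \<alpha> * \<bar>t - s\<bar>))"

text \<open>The operators \<open>U(t,s)\<close> on the scale \<open>Y\<close> and their restrictions to the smaller scale \<open>X\<close> are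
  denoted by the same functions \<open>U t s \<alpha>' \<alpha>\<close>. Differentiability is that of the partial maps.\<close>

definition cond_A4 ::
    "real \<Rightarrow> real \<Rightarrow> (real \<Rightarrow> 'a::real_vector nspace) \<Rightarrow> (real \<Rightarrow> 'a nspace) \<Rightarrow> real
      \<Rightarrow> (real \<Rightarrow> real \<Rightarrow> real \<Rightarrow> real \<Rightarrow> 'a \<Rightarrow> 'a) \<Rightarrow> (real \<Rightarrow> real \<Rightarrow> real \<Rightarrow> 'a \<Rightarrow> 'a) \<Rightarrow> bool" where
  "cond_A4 al au X Y T U A \<longleftrightarrow>
     (\<forall>t. 0 \<le> t \<and> t < T \<longrightarrow> bounded_linear_operator al au X Y (A t)) \<and>
     (\<forall>t s. 0 \<le> s \<and> s \<le> t \<and> t < T \<longrightarrow> bounded_linear_operator al au Y Y (U t s)) \<and>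
     (\<forall>\<alpha>' \<alpha>. al \<le> \<alpha>' \<and> \<alpha>' < \<alpha> \<and> \<alpha> \<le> au \<longrightarrow>
        (\<forall>y\<in>pts (X \<alpha>'). continuous_map (top_of_set {0..<T}) (ntop (Y \<alpha>)) (\<lambda>t. A t \<alpha>' \<alpha> y)) \<and>
        (\<forall>y\<in>pts (Y \<alpha>'). continuous_map (top_of_set (time_triangle T)) (ntop (Y \<alpha>))
           (\<lambda>(t, s). U t s \<alpha>' \<alpha> y)) \<and>
        (\<forall>y\<in>pts (X \<alpha>'). \<forall>t s \<delta>. 0 \<le> s \<and> s \<le> t \<and> t < T \<and> \<alpha>' < \<delta> \<and> \<delta> < \<alpha> \<longrightarrow>
           has_nderiv (Y \<alpha>) (\<lambda>h. U h s \<alpha>' \<alpha> y) (A t \<delta> \<alpha> (U t s \<alpha>' \<delta> y)) t {s..<T} \<and>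
           has_nderiv (Y \<alpha>) (\<lambda>h. U t h \<alpha>' \<alpha> y) (- U t s \<delta> \<alpha> (A s \<alpha>' \<delta> y)) s {0..t}))"

definition cond_B1 ::
    "real \<Rightarrow> real \<Rightarrow> (real \<Rightarrow> 'a::real_vector nspace) \<Rightarrow> real \<Rightarrow> ereal \<Rightarrow> 'a
      \<Rightarrow> (real \<Rightarrow> real \<Rightarrow> real \<Rightarrow> 'a \<Rightarrow> 'a) \<Rightarrow> bool" where
  "cond_B1 al au X T r x B \<longleftrightarrow>
     0 < r \<and>
     (\<forall>t. 0 \<le> t \<and> t < T \<longrightarrow> nonlinear_operator al au X r x (B t)) \<and>
     (\<forall>\<alpha>' \<alpha>. al \<le> \<alpha>' \<and> \<alpha>' < \<alpha> \<and> \<alpha> \<le> au \<longrightarrow>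
        continuous_map
          (prod_topology (subtopology (ntop (X \<alpha>')) (sball X r x \<alpha>')) (top_of_set {0..<T}))
          (ntop (X \<alpha>)) (\<lambda>(v, t). B t \<alpha>' \<alpha> v))"

definition cond_B2 ::
    "real \<Rightarrow> real \<Rightarrow> (real \<Rightarrow> 'a::real_vector nspace) \<Rightarrow> real \<Rightarrow> ereal \<Rightarrow> 'a
      \<Rightarrow> (real \<Rightarrow> real \<Rightarrow> real \<Rightarrow> 'a \<Rightarrow> 'a) \<Rightarrow> real \<Rightarrow> real \<Rightarrow> bool" where
  "cond_B2 al au X T r x B C2 \<beta> \<longleftrightarrow>
     0 < C2 \<and>
     (\<forall>\<alpha>' \<alpha> t. al \<le> \<alpha>' \<and> \<alpha>' < \<alpha> \<and> \<alpha> \<le> au \<and> 0 \<le> t \<and> t < T \<longrightarrow>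
        (\<forall>v\<in>sball X r x \<alpha>'. \<forall>w\<in>sball X r x \<alpha>'.
           nrm (X \<alpha>) (B t \<alpha>' \<alpha> v - B t \<alpha>' \<alpha> w)
             \<le> C2 / (\<alpha> - \<alpha>') powr (1 - \<beta>) * nrm (X \<alpha>') (v - w)))"

definition cond_B3 ::
    "real \<Rightarrow> real \<Rightarrow> (real \<Rightarrow> 'a::real_vector nspace) \<Rightarrow> real \<Rightarrow> 'a
      \<Rightarrow> (real \<Rightarrow> real \<Rightarrow> real \<Rightarrow> 'a \<Rightarrow> 'a) \<Rightarrow> real \<Rightarrow> bool" where
  "cond_B3 al au X T x B C3 \<longleftrightarrow>
     0 < C3 \<and>
     (\<forall>\<alpha> t. al < \<alpha> \<and> \<alpha> \<le> au \<and> 0 \<le> t \<and> t < T \<longrightarrow>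
        nrm (X \<alpha>) (B t al \<alpha> x) \<le> C3 / (\<alpha> - al))"

text \<open>The arguments \<open>nx\<close> and \<open>Cx\<close> stand for the norm of \<open>x\<close> in the smallest space of the scale and
  for the constant \<open>C(x,\<alpha>0)\<close>. In extended reals \<open>1 / \<infinity> = 0\<close>.\<close>

definition lambda0 ::
    "real \<Rightarrow> real \<Rightarrow> real \<Rightarrow> real \<Rightarrow> real \<Rightarrow> real \<Rightarrow> real \<Rightarrow> real \<Rightarrow> real \<Rightarrow> real \<Rightarrow> ereal \<Rightarrow> real \<Rightarrow> real"
  where
  "lambda0 al au C1 C2 C3 \<beta> nx Cx \<alpha>0 \<gamma> r' T =
     (let rinv = real_of_ereal (1 / r') in
      Max {(au - al) / T,
           2 powr (2 * \<gamma> + 1 - \<beta>) * C1 * C2 / (\<gamma> - \<beta>),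
           4 powr (1 - \<beta>) * C2 * (au - \<alpha>0) powr \<beta> / (\<gamma> * (1 + nx))
             + 2 powr (2 + \<gamma>) * C1 * C2 / \<gamma>,
           Cx * (au - \<alpha>0) * rinv
             + C1 * (C3 / (\<alpha>0 - al) + Cx) * (au - \<alpha>0) * (1 + nx) / (1 - \<gamma>) * rinv})"

section \<open>Solutions\<close>

text \<open>Both notions concern functions \<open>u\<close> on \<open>[0, (au - \<alpha>0) / lam)\<close>; values of \<open>u\<close> elsewhere are
  irrelevant. Continuity into \<open>X \<alpha>\<close> includes \<open>u t \<in> pts (X \<alpha>)\<close>.\<close>

definition integral_solution ::
    "real \<Rightarrow> real \<Rightarrow> (real \<Rightarrow> 'a::real_vector nspace) \<Rightarrow> ereal \<Rightarrow> 'a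
      \<Rightarrow> (real \<Rightarrow> real \<Rightarrow> real \<Rightarrow> real \<Rightarrow> 'a \<Rightarrow> 'a) \<Rightarrow> (real \<Rightarrow> real \<Rightarrow> real \<Rightarrow> 'a \<Rightarrow> 'a)
      \<Rightarrow> real \<Rightarrow> real \<Rightarrow> (real \<Rightarrow> 'a) \<Rightarrow> bool" where
  "integral_solution al au X r x U B \<alpha>0 lam u \<longleftrightarrow>
     (\<forall>\<alpha>. \<alpha>0 < \<alpha> \<and> \<alpha> \<le> au \<longrightarrow>
        continuous_map (top_of_set {0..<(\<alpha> - \<alpha>0) / lam}) (ntop (X \<alpha>)) u \<and>
        (\<forall>t. 0 \<le> t \<and> t < (\<alpha> - \<alpha>0) / lam \<longrightarrow> u t \<in> sball X r x \<alpha>) \<and>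
        (\<forall>t. 0 \<le> t \<and> t < (\<alpha> - \<alpha>0) / lam \<longrightarrow>
           (\<exists>\<alpha>' \<alpha>'' I. \<alpha>0 \<le> \<alpha>' \<and> \<alpha>' < \<alpha>'' \<and> \<alpha>'' < \<alpha> \<and> t < (\<alpha>' - \<alpha>0) / lam \<and>
              has_nintegral (X \<alpha>) (\<lambda>s. U t s \<alpha>'' \<alpha> (B s \<alpha>' \<alpha>'' (u s))) I 0 t \<and>
              u t = U t 0 al \<alpha> x + I)))"

text \<open>The right-hand side of the differential equation is required to be as stated for every
  admissible \<open>\<alpha>'\<close>; such indices exist for each \<open>t < (\<alpha> - \<alpha>0) / lam\<close>, and by compatibility the
  value does not depend on the choice.\<close>

definition classical_solution ::
    "real \<Rightarrow> (real \<Rightarrow> 'a::real_vector nspace) \<Rightarrow> (real \<Rightarrow> 'a nspace) \<Rightarrow> ereal \<Rightarrow> 'a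
      \<Rightarrow> (real \<Rightarrow> real \<Rightarrow> real \<Rightarrow> 'a \<Rightarrow> 'a) \<Rightarrow> (real \<Rightarrow> real \<Rightarrow> real \<Rightarrow> 'a \<Rightarrow> 'a)
      \<Rightarrow> real \<Rightarrow> real \<Rightarrow> (real \<Rightarrow> 'a) \<Rightarrow> bool" where
  "classical_solution au X Y r x A B \<alpha>0 lam u \<longleftrightarrow>
     u 0 = x \<and>
     (\<forall>\<alpha>. \<alpha>0 < \<alpha> \<and> \<alpha> \<le> au \<longrightarrow>
        continuous_map (top_of_set {0..<(\<alpha> - \<alpha>0) / lam}) (ntop (X \<alpha>)) u \<and>
        (\<forall>t. 0 \<le> t \<and> t < (\<alpha> - \<alpha>0) / lam \<longrightarrow> u t \<in> sball X r x \<alpha>) \<and>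
        (\<exists>u'. continuous_map (top_of_set {0..<(\<alpha> - \<alpha>0) / lam}) (ntop (Y \<alpha>)) u' \<and>
           (\<forall>t. 0 \<le> t \<and> t < (\<alpha> - \<alpha>0) / lam \<longrightarrow>
              has_nderiv (Y \<alpha>) u (u' t) t {0..<(\<alpha> - \<alpha>0) / lam} \<and>
              (\<forall>\<alpha>'. \<alpha>0 < \<alpha>' \<and> \<alpha>' < \<alpha> \<and> t < (\<alpha>' - \<alpha>0) / lam \<longrightarrow>
                 u' t = A t \<alpha>' \<alpha> (u t) + B t \<alpha>' \<alpha> (u t)))))"

end

theory Submission
  imports Defs
begin

text \<open>
  By the cocycle property the integral equation gives, for \<open>p \<le> q\<close>,
  \<open>u(q) = U(q,p) u(p) + \<integral>\<^sub>p\<^sup>q U(q,s) B(u(s),s) ds\<close>. Letting \<open>q\<close> decrease to \<open>p\<close>, condition A4 and the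
  joint continuity of \<open>(q,s) \<mapsto> U(q,s) B(u(s),s)\<close> show that \<open>u\<close> has the right derivative
  \<open>A(p) u(p) + B(u(p),p)\<close> in the scale \<open>E\<close>. By the uniform boundedness principle \<open>A(\<cdot>)\<close> is locally
  bounded in operator norm, so this right derivative is continuous in \<open>p\<close>; a continuous function
  with continuous right derivative is continuously differentiable, so no integral has to be
  differentiated with respect to a parameter.
\<close>


text \<open>Every operator costs some index: \<open>B\<close> leads from \<open>a\<close> to a
  larger \<open>b\<close>, \<open>U\<close> to a still larger index, and \<open>u t\<close> is known
  to lie in \<open>BB a\<close> only while \<open>t < Tm a\<close>. Local statements therefore fix a
  chain of indices starting with \<open>a\<close> and hold before \<open>Tm a\<close>; since no
  value depends on the chosen indices, they can be glued into one statement before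
  \<open>Tm d\<close>. The integrand U(q,s) B(u(s),s) depends on q as well as on s. A right
  difference quotient at p meets A4 on the diagonal, for h -> U(h,p) u(p) at h = p with the vector
  u(p) fixed; left quotients are then recovered from a mean value inequality. An integral over [p,q]
  is never formed. The equations at p and q are compared through Riemann sums, and the sum over
  [p,q] is compared directly with (q - p) w for a vector w near the integrand.\<close>

locale nspace =
  fixes X :: "'a::real_vector nspace"
  assumes normed: "normed_space X"
begin

sublocale Metric_space "pts X" "ndist X"
  using normed by (rule Metric_space_ndist)

lemma sub: "subspace (pts X)"
  using normed by (simp add: normed_space_def)

lemma pts_arith [simp, intro]:
  "0 \<in> pts X"
  "v \<in> pts X \<Longrightarrow> w \<in> pts X \<Longrightarrow> v + w \<in> pts X"
  "v \<in> pts X \<Longrightarrow> w \<in> pts X \<Longrightarrow> v - w \<in> pts X"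
  "v \<in> pts X \<Longrightarrow> - v \<in> pts X"
  "v \<in> pts X \<Longrightarrow> c *\<^sub>R v \<in> pts X"
  using sub by (auto simp: subspace_0 subspace_add subspace_diff subspace_neg subspace_scale)

lemma pts_sum: "(\<And>i. i \<in> P \<Longrightarrow> g i \<in> pts X) \<Longrightarrow> sum g P \<in> pts X"
  using sub by (rule subspace_sum)

lemma nrm_nonneg: "v \<in> pts X \<Longrightarrow> 0 \<le> nrm X v"
  and nrm_eq_0: "v \<in> pts X \<Longrightarrow> nrm X v = 0 \<longleftrightarrow> v = 0"
  and nrm_scale: "v \<in> pts X \<Longrightarrow> nrm X (c *\<^sub>R v) = \<bar>c\<bar> * nrm X v"
  and nrm_add: "v \<in> pts X \<Longrightarrow> w \<in> pts X \<Longrightarrow> nrm X (v + w) \<le> nrm X v + nrm X w"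
  using normed by (simp_all add: normed_space_def)

lemma nrm_0 [simp]: "nrm X 0 = 0"
  using nrm_eq_0 by simp

lemma nrm_commute: "v \<in> pts X \<Longrightarrow> w \<in> pts X \<Longrightarrow> nrm X (v - w) = nrm X (w - v)"
  using nrm_scale[of "v - w" "- 1"] by simp

lemma nrm_diff_triangle:
  "u \<in> pts X \<Longrightarrow> v \<in> pts X \<Longrightarrow> w \<in> pts X \<Longrightarrow> nrm X (u - w) \<le> nrm X (u - v) + nrm X (v - w)"
  using nrm_add[of "u - v" "v - w"] by simp

lemma nrm_sum: "(\<And>i. i \<in> P \<Longrightarrow> g i \<in> pts X) \<Longrightarrow> nrm X (sum g P) \<le> (\<Sum>i\<in>P. nrm X (g i))"
proof (induction P rule: infinite_finite_induct)
  case (insert i P)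
  then have "nrm X (sum g (insert i P)) \<le> nrm X (g i) + nrm X (sum g P)"
    by (simp add: nrm_add pts_sum)
  with insert show ?case by fastforce
qed auto

lemma limitin_ntop:
  "limitin (ntop X) f l F \<longleftrightarrow>
     l \<in> pts X \<and> (\<forall>\<epsilon>>0. \<forall>\<^sub>F h in F. f h \<in> pts X \<and> nrm X (f h - l) < \<epsilon>)"
  unfolding limitin_metric by (auto simp: ndist_def elim!: eventually_mono)

end

section \<open>Continuity and differentiability in epsilon-delta form\<close>

lemma atin_within_euclidean: "atin_within euclidean a S = at a within S"
  by (auto simp: filter_eq_iff eventually_atin_within eventually_at_topological)

lemma (in nspace) continuous_map_ntop:
  fixes f :: "'b::metric_space \<Rightarrow> 'a"
  shows "continuous_map (top_of_set S) (ntop X) f \<longleftrightarrow>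
     (\<forall>t\<in>S. f t \<in> pts X \<and> (\<forall>\<epsilon>>0. \<exists>\<delta>>0. \<forall>s\<in>S. dist s t < \<delta> \<longrightarrow> nrm X (f s - f t) < \<epsilon>))"
    (is "?L \<longleftrightarrow> ?R")
proof -
  have "?L \<longleftrightarrow> (\<forall>t\<in>S. limitin (ntop X) f (f t) (at t within S))"
    by (simp add: continuous_map_atin atin_subtopology_within atin_within_euclidean)
  also have "\<dots> \<longleftrightarrow> ?R"
  proof (intro iffI ballI conjI allI impI)
    fix t \<epsilon> :: _ assume *: "\<forall>t\<in>S. limitin (ntop X) f (f t) (at t within S)" "t \<in> S"
    then show "f t \<in> pts X" by (auto simp: limitin_ntop)
    assume "(0::real) < \<epsilon>"
    with * have "\<forall>\<^sub>F h in at t within S. f h \<in> pts X \<and> nrm X (f h - f t) < \<epsilon>"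
      by (simp add: limitin_ntop)
    then show "\<exists>\<delta>>0. \<forall>s\<in>S. dist s t < \<delta> \<longrightarrow> nrm X (f s - f t) < \<epsilon>"
      unfolding eventually_at using \<open>0 < \<epsilon>\<close>
      by (metis cancel_comm_monoid_add_class.diff_cancel nrm_0)
  next
    fix t assume *: ?R "t \<in> S"
    then show "limitin (ntop X) f (f t) (at t within S)"
      unfolding limitin_ntop eventually_at by blast
  qed
  finally show ?thesis .
qed

lemma (in nspace) continuous_map_ntopD:
  fixes f :: "'b::metric_space \<Rightarrow> 'a"
  assumes "continuous_map (top_of_set S) (ntop X) f" "t \<in> S" "0 < \<epsilon>"
  shows "\<exists>\<delta>>0. \<forall>s\<in>S. dist s t < \<delta> \<longrightarrow> nrm X (f s - f t) < \<epsilon>"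
  using assms unfolding continuous_map_ntop by blast

text \<open>Clearing the denominator gives a remainder estimate that can be added up by the triangle
  inequality. It includes h = t, where both sides vanish, so the inequality has to be weak.\<close>

lemma (in nspace) has_nderiv_iff:
  assumes "t \<in> S" "\<And>h. h \<in> S \<Longrightarrow> f h \<in> pts X"
  shows "has_nderiv X f d t S \<longleftrightarrow> d \<in> pts X \<and>
     (\<forall>\<epsilon>>0. \<exists>\<delta>>0. \<forall>h\<in>S. \<bar>h - t\<bar> < \<delta> \<longrightarrow> nrm X (f h - f t - (h - t) *\<^sub>R d) \<le> \<epsilon> * \<bar>h - t\<bar>)"
    (is "_ \<longleftrightarrow> _ \<and> (\<forall>\<epsilon>>0. \<exists>\<delta>>0. ?P \<epsilon> \<delta>)")
proof -
  have *: "nrm X (f h - f t - (h - t) *\<^sub>R d) = \<bar>h - t\<bar> * nrm X ((1 / (h - t)) *\<^sub>R (f h - f t) - d)"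
    if "h \<in> S" "h \<noteq> t" "d \<in> pts X" for h
  proof -
    have "f h - f t - (h - t) *\<^sub>R d = (h - t) *\<^sub>R ((1 / (h - t)) *\<^sub>R (f h - f t) - d)"
      using that by (simp add: scaleR_diff_right)
    then show ?thesis using that assms by (simp add: nrm_scale)
  qed
  have lim: "has_nderiv X f d t S \<longleftrightarrow> d \<in> pts X \<and>
     (\<forall>\<epsilon>>0. \<exists>\<delta>>0. \<forall>h\<in>S. h \<noteq> t \<and> dist h t < \<delta> \<longrightarrow>
        nrm X ((1 / (h - t)) *\<^sub>R (f h - f t) - d) < \<epsilon>)"
    unfolding has_nderiv_def limitin_ntop eventually_at using assms by blast
  show ?thesis
  proof (cases "d \<in> pts X")
    case d: True
    have "(\<forall>\<epsilon>>0. \<exists>\<delta>>0. ?P \<epsilon> \<delta>) \<longleftrightarrow> (\<forall>\<epsilon>>0. \<exists>\<delta>>0. \<forall>h\<in>S. h \<noteq> t \<and> dist h t < \<delta> \<longrightarrow>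
        nrm X ((1 / (h - t)) *\<^sub>R (f h - f t) - d) < \<epsilon>)"
    proof (intro iffI allI impI)
      fix \<epsilon> :: real assume "\<epsilon> > 0" and H: "\<forall>\<epsilon>>0. \<exists>\<delta>>0. ?P \<epsilon> \<delta>"
      \<comment> \<open>Half of \<epsilon> turns the weak inequality back into a strict one.\<close>
      then obtain \<delta> where \<delta>: "\<delta> > 0" "?P (\<epsilon> / 2) \<delta>" using half_gt_zero by blast
      have "nrm X ((1 / (h - t)) *\<^sub>R (f h - f t) - d) < \<epsilon>"
        if "h \<in> S" "h \<noteq> t" "dist h t < \<delta>" for h
      proof -
        have "\<bar>h - t\<bar> * nrm X ((1 / (h - t)) *\<^sub>R (f h - f t) - d) \<le> \<bar>h - t\<bar> * (\<epsilon> / 2)"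
          using \<delta>(2)[rule_format, OF that(1)] that(3) unfolding *[OF that(1,2) d] dist_real_def
          by (simp add: mult.commute)
        then have "nrm X ((1 / (h - t)) *\<^sub>R (f h - f t) - d) \<le> \<epsilon> / 2"
          using that(2) by (subst (asm) mult_le_cancel_left_pos) auto
        then show ?thesis using \<open>\<epsilon> > 0\<close> by linarith
      qed
      then show "\<exists>\<delta>>0. \<forall>h\<in>S. h \<noteq> t \<and> dist h t < \<delta> \<longrightarrow>
        nrm X ((1 / (h - t)) *\<^sub>R (f h - f t) - d) < \<epsilon>" using \<delta>(1) by blast
    next
      fix \<epsilon> :: real assume "\<epsilon> > 0" and H: "\<forall>\<epsilon>>0. \<exists>\<delta>>0. \<forall>h\<in>S. h \<noteq> t \<and> dist h t < \<delta> \<longrightarrow>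
        nrm X ((1 / (h - t)) *\<^sub>R (f h - f t) - d) < \<epsilon>"
      then obtain \<delta> where \<delta>: "\<delta> > 0" "\<And>h. h\<in>S \<Longrightarrow> h \<noteq> t \<Longrightarrow> dist h t < \<delta> \<Longrightarrow>
        nrm X ((1 / (h - t)) *\<^sub>R (f h - f t) - d) < \<epsilon>" by metis
      have "?P \<epsilon> \<delta>"
      proof (intro ballI impI)
        fix h assume h: "h \<in> S" "\<bar>h - t\<bar> < \<delta>"
        show "nrm X (f h - f t - (h - t) *\<^sub>R d) \<le> \<epsilon> * \<bar>h - t\<bar>"
        proof (cases "h = t")
          case False
          with h \<delta>(2)[of h] *[OF h(1) False d] show ?thesis
            by (simp add: dist_real_def mult.commute)
        qed simp
      qed
      then show "\<exists>\<delta>>0. ?P \<epsilon> \<delta>" using \<delta>(1) by blast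
    qed
    then show ?thesis using lim d by blast
  qed (use lim in blast)
qed

section \<open>From right derivatives to two-sided derivatives\<close>

text \<open>Supremum argument: let m be the supremum of the times up to which the bound holds.
  Continuity carries the bound to m itself, and the local estimate to the right of m would carry it
  further if m < b.\<close>

lemma (in nspace) mean_value_right:
  fixes F :: "real \<Rightarrow> 'a"
  assumes "a \<le> b" "0 \<le> c"
    and F: "\<And>t. t \<in> {a..b} \<Longrightarrow> F t \<in> pts X"
    and cont: "\<And>t \<epsilon>. t \<in> {a..b} \<Longrightarrow> 0 < \<epsilon> \<Longrightarrow>
      \<exists>\<delta>>0. \<forall>s\<in>{a..b}. \<bar>s - t\<bar> < \<delta> \<longrightarrow> nrm X (F s - F t) < \<epsilon>"
    and right: "\<And>t. t \<in> {a..<b} \<Longrightarrow>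
      \<exists>\<delta>>0. \<forall>s\<in>{t..b}. s - t < \<delta> \<longrightarrow> nrm X (F s - F t) \<le> c * (s - t)"
  shows "nrm X (F b - F a) \<le> c * (b - a)"
proof -
  \<comment> \<open>Asking for the bound at all earlier times makes \<open>S\<close> an initial
    segment of [a, b], so every s below its supremum inherits the bound.\<close>
  define S where "S = {t \<in> {a..b}. \<forall>s\<in>{a..t}. nrm X (F s - F a) \<le> c * (s - a)}"
  define m where "m = Sup S"
  have aS: "a \<in> S" using assms(1) by (simp add: S_def)
  have Sb: "t \<le> b" if "t \<in> S" for t using that by (simp add: S_def)
  then have bdd: "bdd_above S" by (rule bdd_aboveI)
  have m: "a \<le> m" "m \<le> b"
    unfolding m_def using aS bdd Sb cSup_upper[of a S] cSup_least[of S b] by blast+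
  have below: "nrm X (F s - F a) \<le> c * (s - a)" if s: "a \<le> s" "s < m" for s
  proof -
    obtain t where "t \<in> S" "s < t"
      using s(2) aS less_cSupD[of S s] unfolding m_def by blast
    then show ?thesis using s by (auto simp: S_def)
  qed
  have at_m: "nrm X (F m - F a) \<le> c * (m - a)"
  proof (cases "m = a")
    case False
    show ?thesis
    proof (rule field_le_epsilon)
      fix \<epsilon> :: real assume "0 < \<epsilon>"
      then obtain \<delta> where \<delta>: "\<delta> > 0" "\<forall>s\<in>{a..b}. \<bar>s - m\<bar> < \<delta> \<longrightarrow> nrm X (F s - F m) < \<epsilon>"
        using cont m by (meson atLeastAtMost_iff)
      define s where "s = max a (m - \<delta> / 2)"
      have s: "a \<le> s" "s < m" "\<bar>s - m\<bar> < \<delta>" "s \<in> {a..b}" using m False \<delta> by (auto simp: s_def)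
      have "nrm X (F m - F a) \<le> nrm X (F m - F s) + nrm X (F s - F a)"
        using F m s by (intro nrm_diff_triangle) auto
      also have "nrm X (F m - F s) = nrm X (F s - F m)" using F m s by (intro nrm_commute) auto
      also have "\<dots> < \<epsilon>" using \<delta> s by auto
      also have "nrm X (F s - F a) \<le> c * (s - a)" using below s by auto
      also have "c * (s - a) \<le> c * (m - a)" using s assms(2) by (intro mult_left_mono) auto
      finally show "nrm X (F m - F a) \<le> c * (m - a) + \<epsilon>" by simp
    qed
  qed simp
  have "m = b"
  proof (rule ccontr)
    assume "m \<noteq> b"
    with m obtain \<delta> where \<delta>: "\<delta> > 0" "\<forall>s\<in>{m..b}. s - m < \<delta> \<longrightarrow> nrm X (F s - F m) \<le> c * (s - m)"
      using right[of m] by auto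
    define t where "t = min b (m + \<delta> / 2)"
    have t: "m < t" "t \<le> b" "t - m < \<delta>" using \<delta> m \<open>m \<noteq> b\<close> by (auto simp: t_def)
    have "nrm X (F s - F a) \<le> c * (s - a)" if "a \<le> s" "s \<le> t" for s
    proof (cases "s < m")
      case False
      have "nrm X (F s - F a) \<le> nrm X (F s - F m) + nrm X (F m - F a)"
        using F m that t by (intro nrm_diff_triangle) auto
      also have "\<dots> \<le> c * (s - m) + c * (m - a)"
        using \<delta> t at_m that False by (intro add_mono) auto
      finally show ?thesis by (simp add: algebra_simps)
    qed (use below that in auto)
    then have "t \<in> S" using t m by (auto simp: S_def)
    then have "t \<le> m" unfolding m_def using bdd by (rule cSup_upper)
    with t show False by simp
  qed
  with at_m show ?thesis by simp
qed

text \<open>Subtracting the linear function \<open>s *\<^sub>R g t\<close> leaves a function with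
  right derivative \<open>g z - g t\<close> at z, which is small near t because \<open>g\<close> is
  continuous. The mean value inequality bounds its increments on either side of t.\<close>

lemma (in nspace) has_nderiv_if_right_deriv:
  fixes F g :: "real \<Rightarrow> 'a"
  assumes F: "continuous_map (top_of_set {a..<b}) (ntop X) F"
    and g: "continuous_map (top_of_set {a..<b}) (ntop X) g"
    and right: "\<And>t \<epsilon>. t \<in> {a..<b} \<Longrightarrow> 0 < \<epsilon> \<Longrightarrow>
      \<exists>\<delta>>0. \<forall>s\<in>{t..<b}. s - t < \<delta> \<longrightarrow> nrm X (F s - F t - (s - t) *\<^sub>R g t) \<le> \<epsilon> * (s - t)"
    and t: "t \<in> {a..<b}"
  shows "has_nderiv X F (g t) t {a..<b}"
proof -
  have Fp: "F s \<in> pts X" and gp: "g s \<in> pts X" if "s \<in> {a..<b}" for s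
    using F g that unfolding continuous_map_ntop by blast+
  have "g t \<in> pts X \<and> (\<forall>\<epsilon>>0. \<exists>\<delta>>0. \<forall>h\<in>{a..<b}. \<bar>h - t\<bar> < \<delta> \<longrightarrow>
        nrm X (F h - F t - (h - t) *\<^sub>R g t) \<le> \<epsilon> * \<bar>h - t\<bar>)"
  proof (intro conjI allI impI)
    show "g t \<in> pts X" by (rule gp[OF t])
    fix \<epsilon> :: real assume \<epsilon>: "0 < \<epsilon>"
    then obtain \<delta> where \<delta>: "\<delta> > 0" "\<And>s. s \<in> {a..<b} \<Longrightarrow> \<bar>s - t\<bar> < \<delta> \<Longrightarrow> nrm X (g s - g t) < \<epsilon> / 2"
      using g t unfolding continuous_map_ntop dist_real_def by (metis half_gt_zero)
    define G where "G = (\<lambda>s. F s - s *\<^sub>R g t)"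
    have Gp: "G s \<in> pts X" if "s \<in> {a..<b}" for s using Fp gp t that by (auto simp: G_def)
    have key: "nrm X (G q - G p) \<le> \<epsilon> * (q - p)"
      if pq: "p \<in> {a..<b}" "q \<in> {a..<b}" "p \<le> q" "\<bar>p - t\<bar> < \<delta>" "\<bar>q - t\<bar> < \<delta>" for p q
    proof (rule mean_value_right)
      show "G s \<in> pts X" if "s \<in> {p..q}" for s using that pq by (intro Gp) auto
      show "\<exists>\<delta>>0. \<forall>s\<in>{p..q}. \<bar>s - z\<bar> < \<delta> \<longrightarrow> nrm X (G s - G z) < e"
        if z: "z \<in> {p..q}" and e: "0 < e" for z e
      proof -
        have zb: "z \<in> {a..<b}" using z pq by auto
        obtain \<eta> where \<eta>: "\<eta> > 0" "\<And>s. s \<in> {a..<b} \<Longrightarrow> \<bar>s - z\<bar> < \<eta> \<Longrightarrow> nrm X (F s - F z) < e / 2"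
          using F zb e unfolding continuous_map_ntop dist_real_def by (metis half_gt_zero)
        \<comment> \<open>The added 1 keeps the divisor positive when
          \<open>g t = 0\<close>.\<close>
        define N where "N = nrm X (g t) + 1"
        have N: "N > 0" "nrm X (g t) \<le> N" using nrm_nonneg[OF gp[OF t]] by (auto simp: N_def)
        have "nrm X (G s - G z) < e" if s: "s \<in> {p..q}" "\<bar>s - z\<bar> < min \<eta> (e / (2 * N))" for s
        proof -
          have sb: "s \<in> {a..<b}" using s pq by auto
          have "nrm X (G s - G z) = nrm X ((F s - F z) + (z - s) *\<^sub>R g t)"
            by (simp add: G_def algebra_simps)
          also have "\<dots> \<le> nrm X (F s - F z) + \<bar>z - s\<bar> * nrm X (g t)"
            using nrm_add[of "F s - F z" "(z - s) *\<^sub>R g t"] Fp sb zb gp t by (simp add: nrm_scale)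
          also have "\<bar>z - s\<bar> * nrm X (g t) \<le> e / (2 * N) * N"
            using s N nrm_nonneg[OF gp[OF t]] by (intro mult_mono) auto
          also have "\<dots> = e / 2" using N by simp
          also have "nrm X (F s - F z) < e / 2" using \<eta> sb s by auto
          finally show ?thesis by simp
        qed
        then show ?thesis using \<eta> N e by (intro exI[of _ "min \<eta> (e / (2 * N))"]) auto
      qed
      show "\<exists>\<delta>>0. \<forall>s\<in>{z..q}. s - z < \<delta> \<longrightarrow> nrm X (G s - G z) \<le> \<epsilon> * (s - z)"
        if z: "z \<in> {p..<q}" for z
      proof -
        have zb: "z \<in> {a..<b}" "\<bar>z - t\<bar> < \<delta>" using z pq by auto
        \<comment> \<open>One half of \<epsilon> pays for the remainder of the right derivative at
          z, the other half for \<open>g z - g t\<close>.\<close>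
        obtain \<eta> where \<eta>: "\<eta> > 0"
          "\<And>s. s\<in>{z..<b} \<Longrightarrow> s - z < \<eta> \<Longrightarrow> nrm X (F s - F z - (s - z) *\<^sub>R g z) \<le> \<epsilon> / 2 * (s - z)"
          using right[OF zb(1), of "\<epsilon> / 2"] \<epsilon> by auto
        have "nrm X (G s - G z) \<le> \<epsilon> * (s - z)" if s: "s \<in> {z..q}" "s - z < \<eta>" for s
        proof -
          have sb: "s \<in> {a..<b}" "s \<in> {z..<b}" using s pq zb by auto
          have "nrm X (G s - G z) = nrm X ((F s - F z - (s - z) *\<^sub>R g z) + (s - z) *\<^sub>R (g z - g t))"
            by (simp add: G_def algebra_simps)
          also have "\<dots> \<le> nrm X (F s - F z - (s - z) *\<^sub>R g z) + (s - z) * nrm X (g z - g t)"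
            using nrm_add[of "F s - F z - (s - z) *\<^sub>R g z" "(s - z) *\<^sub>R (g z - g t)"] Fp sb zb gp t s
            by (simp add: nrm_scale)
          also have "\<dots> \<le> \<epsilon> / 2 * (s - z) + (s - z) * (\<epsilon> / 2)"
            using \<eta>(2)[OF sb(2) s(2)] \<delta>(2)[OF zb] s by (intro add_mono mult_left_mono) auto
          finally show ?thesis by (simp add: algebra_simps)
        qed
        then show ?thesis using \<eta>(1) by blast
      qed
    qed (use pq \<epsilon> in auto)
    have "nrm X (F h - F t - (h - t) *\<^sub>R g t) \<le> \<epsilon> * \<bar>h - t\<bar>" if h: "h \<in> {a..<b}" "\<bar>h - t\<bar> < \<delta>" for h
    proof -
      have eq: "F h - F t - (h - t) *\<^sub>R g t = G h - G t" by (simp add: G_def algebra_simps)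
      show ?thesis
      proof (cases "t \<le> h")
        case True
        then show ?thesis using key[of t h] t h \<delta>(1) by (simp add: eq)
      next
        \<comment> \<open>To the left of t the inequality is run from h up to t.\<close>
        case False
        then show ?thesis using key[of h t] t h \<delta>(1) nrm_commute[of "G h" "G t"] Gp by (simp add: eq)
      qed
    qed
    then show "\<exists>\<delta>>0. \<forall>h\<in>{a..<b}. \<bar>h - t\<bar> < \<delta> \<longrightarrow>
        nrm X (F h - F t - (h - t) *\<^sub>R g t) \<le> \<epsilon> * \<bar>h - t\<bar>"
      using \<delta>(1) by blast
  qed
  then show ?thesis using has_nderiv_iff[OF t Fp] by simp
qed

section \<open>Bounded linear maps and uniform boundedness\<close>

lemma bounded_linear_betweenD:
  assumes "bounded_linear_between X Y f" and v: "v \<in> pts X" "w \<in> pts X"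
  shows "f v \<in> pts Y" "f (v + w) = f v + f w" "f (c *\<^sub>R v) = c *\<^sub>R f v"
  using assms unfolding bounded_linear_between_def by blast+

lemma bounded_linear_between_diff:
  assumes "nspace X" "bounded_linear_between X Y f" "v \<in> pts X" "w \<in> pts X"
  shows "f (v - w) = f v - f w"
proof -
  have "f (v + - 1 *\<^sub>R w) = f v + - 1 *\<^sub>R f w"
    using assms nspace.pts_arith(5)[OF assms(1)] by (metis bounded_linear_betweenD(2,3))
  then show ?thesis by simp
qed

lemma bounded_linear_between_sum:
  assumes X: "nspace X" and f: "bounded_linear_between X Y f"
    and g: "\<And>i. i \<in> P \<Longrightarrow> g i \<in> pts X"
  shows "f (\<Sum>i\<in>P. c i *\<^sub>R g i) = (\<Sum>i\<in>P. c i *\<^sub>R f (g i))"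
proof -
  interpret nspace X by (rule X)
  have "f 0 = 0" using bounded_linear_betweenD(3)[OF f, of 0 0 0] by simp
  with g show ?thesis
  proof (induction P rule: infinite_finite_induct)
    case (insert i P)
    then have "c i *\<^sub>R g i \<in> pts X" "(\<Sum>i\<in>P. c i *\<^sub>R g i) \<in> pts X" "g i \<in> pts X"
      by (auto intro!: pts_sum)
    with insert show ?case
      by (simp add: bounded_linear_betweenD(2)[OF f] bounded_linear_betweenD(3)[OF f, of _ "g i"])
  qed auto
qed

text \<open>A real supremum dominates its members only if they are bounded above; the constant in
  the definition of a bounded linear map supplies such a bound.\<close>

lemma nrm_le_opnorm:
  assumes X: "nspace X" and Y: "nspace Y" and f: "bounded_linear_between X Y f" and v: "v \<in> pts X"
  shows "nrm Y (f v) \<le> opnorm X Y f * nrm X v"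
proof -
  interpret X: nspace X by (rule X)
  interpret Y: nspace Y by (rule Y)
  obtain K where K: "\<And>v. v \<in> pts X \<Longrightarrow> nrm Y (f v) \<le> K * nrm X v"
    using f unfolding bounded_linear_between_def by blast
  have f0: "f 0 = 0" using bounded_linear_betweenD(3)[OF f, of 0 0 0] by simp
  show ?thesis
  proof (cases "v = 0")
    case False
    have pos: "0 < nrm X w" if "w \<in> pts X" "w \<noteq> 0" for w
      using that X.nrm_nonneg X.nrm_eq_0 by fastforce
    \<comment> \<open>The zero vector contributes the quotient 0, which \<open>K\<close> need not
      dominate: on the trivial space \<open>K\<close> may be negative.\<close>
    have "nrm Y (f w) / nrm X w \<le> max K 0" if "w \<in> pts X" for w
    proof (cases "w = 0")
      case False
      then have "nrm Y (f w) / nrm X w \<le> K" using K pos that by (simp add: divide_simps)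
      then show ?thesis by simp
    qed simp
    then have "bdd_above ((\<lambda>v. nrm Y (f v) / nrm X v) ` pts X)" by (auto intro!: bdd_aboveI2)
    then have "nrm Y (f v) / nrm X v \<le> opnorm X Y f"
      unfolding opnorm_def using v by (intro cSUP_upper)
    then show ?thesis using pos[OF v False] by (simp add: divide_simps)
  qed (simp add: f0)
qed

text \<open>Banach-Steinhaus on carrier sets. The closed sets \<open>E n\<close> on which the family
  is bounded by n cover the complete space, so by Baire one of them contains a ball around some y. A
  small multiple of any v is the difference of two points of that ball.\<close>

lemma uniform_boundedness_nspace:
  assumes X: "banach_space X" and Y: "nspace Y"
    and L: "\<And>i. i \<in> S \<Longrightarrow> bounded_linear_between X Y (L i)"
    and bdd: "\<And>v. v \<in> pts X \<Longrightarrow> \<exists>M. \<forall>i\<in>S. nrm Y (L i v) \<le> M"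
  shows "\<exists>K. \<forall>i\<in>S. \<forall>v\<in>pts X. nrm Y (L i v) \<le> K * nrm X v"
proof -
  interpret X: nspace X using X by unfold_locales (simp add: banach_space_def)
  interpret Y: nspace Y by (rule Y)
  define E where "E n = {v \<in> pts X. \<forall>i\<in>S. nrm Y (L i v) \<le> real n}" for n :: nat
  have closed: "closedin (ntop X) (E n)" for n
    unfolding X.closedin_metric
  proof (intro conjI allI impI)
    fix v assume "v \<in> pts X - E n"
    then obtain i where v: "v \<in> pts X" and i: "i \<in> S" "real n < nrm Y (L i v)"
      by (auto simp: E_def not_le)
    obtain K where K: "\<And>w. w \<in> pts X \<Longrightarrow> nrm Y (L i w) \<le> K * nrm X w"
      using L[OF i(1)] unfolding bounded_linear_between_def by blast
    \<comment> \<open>At a distance from v less than this, \<open>L i\<close> cannot bring the norm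
      down to n; the added 1 makes the denominator positive for every \<open>K\<close>.\<close>
    define R where "R = (nrm Y (L i v) - n) / (\<bar>K\<bar> + 1)"
    have "w \<notin> E n" if w: "w \<in> pts X" "nrm X (v - w) < R" for w
    proof
      assume wE: "w \<in> E n"
      have p: "L i v \<in> pts Y" "L i w \<in> pts Y" "v - w \<in> pts X"
        using L[OF i(1)] v w bounded_linear_betweenD(1) by blast+
      have "nrm Y (L i v) \<le> nrm Y (L i v - L i w) + nrm Y (L i w)"
        using Y.nrm_add[of "L i v - L i w" "L i w"] p by simp
      also have "L i v - L i w = L i (v - w)"
        using bounded_linear_between_diff[OF X.nspace_axioms L[OF i(1)] v w(1)] by simp
      also have "nrm Y \<dots> \<le> K * nrm X (v - w)" using K p by blast
      also have "\<dots> \<le> (\<bar>K\<bar> + 1) * nrm X (v - w)"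
        using X.nrm_nonneg[OF p(3)] by (intro mult_right_mono) auto
      also have "\<dots> < (\<bar>K\<bar> + 1) * R" using w by (intro mult_strict_left_mono) auto
      also have "\<dots> = nrm Y (L i v) - n" by (simp add: R_def)
      also have "nrm Y (L i w) \<le> n" using wE i by (auto simp: E_def)
      finally show False by simp
    qed
    moreover have "R > 0" using i by (simp add: R_def)
    ultimately show "\<exists>r>0. disjnt (E n) (X.mball v r)"
      using v by (auto simp: disjnt_iff ndist_def)
  qed (auto simp: E_def)
  have "(\<Union>n. E n) = pts X"
  proof -
    have "\<exists>n. v \<in> E n" if v: "v \<in> pts X" for v
    proof -
      obtain M where "\<forall>i\<in>S. nrm Y (L i v) \<le> M" using bdd v by blast
      then have "v \<in> E (nat \<lceil>M\<rceil>)" using v real_nat_ceiling_ge[of M] by (fastforce simp: E_def)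
      then show ?thesis ..
    qed
    then show ?thesis by (auto simp: E_def)
  qed
  then have "ntop X interior_of (\<Union>(range E)) \<noteq> {}"
    by (metis X.pts_arith(1) X.topspace_mtopology empty_iff interior_of_topspace)
  then have "\<exists>n. ntop X interior_of E n \<noteq> {}"
    using X.metric_Baire_category_alt[of "range E"] X closed by (auto simp: banach_space_def)
  then obtain n y where "y \<in> ntop X interior_of E n" by blast
  then obtain R where R: "R > 0" "X.mball y R \<subseteq> ntop X interior_of E n"
    using openin_interior_of[of "ntop X" "E n"] unfolding X.openin_mtopology by blast
  then have R: "R > 0" "X.mball y R \<subseteq> E n"
    using interior_of_subset[of "ntop X" "E n"] by blast+
  have y: "y \<in> pts X"
    using \<open>y \<in> ntop X interior_of E n\<close> interior_of_subset_topspace[of "ntop X" "E n"] by auto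
  have "nrm Y (L i v) \<le> (4 * n / R) * nrm X v" if i: "i \<in> S" and v: "v \<in> pts X" for i v
  proof (cases "v = 0")
    case True
    then show ?thesis using bounded_linear_betweenD(3)[OF L[OF i], of 0 0 0] by simp
  next
    case False
    define N where "N = nrm X v"
    have N: "N > 0" using False v X.nrm_nonneg X.nrm_eq_0 by (fastforce simp: N_def)
    \<comment> \<open>\<open>c *\<^sub>R v\<close> has norm R/2 and so stays in the open ball; 2n/c
      becomes 4n/R times the norm of v.\<close>
    define c where "c = R / (2 * N)"
    have c: "c > 0" using R N by (simp add: c_def)
    have "nrm X (c *\<^sub>R v) < R" using v c N R(1) by (simp add: X.nrm_scale N_def[symmetric]) (simp add: c_def)
    then have "y + c *\<^sub>R v \<in> X.mball y R" "y \<in> X.mball y R"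
      using y v R(1) X.nrm_commute[of y "y + c *\<^sub>R v"] by (auto simp: ndist_def)
    then have E: "y + c *\<^sub>R v \<in> E n" "y \<in> E n" using R by blast+
    have p: "L i y \<in> pts Y" "L i v \<in> pts Y" "L i (y + c *\<^sub>R v) = L i y + c *\<^sub>R L i v"
      using L[OF i] y v bounded_linear_betweenD(1) apply blast
      using L[OF i] y v bounded_linear_betweenD(1) apply blast
      using y v bounded_linear_betweenD(2,3)[OF L[OF i]] by (metis X.pts_arith(5))
    have "c * nrm Y (L i v) = nrm Y ((L i y + c *\<^sub>R L i v) - L i y)"
      using p c by (simp add: Y.nrm_scale)
    also have "\<dots> \<le> nrm Y (L i y + c *\<^sub>R L i v) + nrm Y (L i y)"
      using p Y.nrm_diff_triangle[of "L i y + c *\<^sub>R L i v" 0 "L i y"] Y.nrm_commute[of 0 "L i y"] by simp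
    also have "\<dots> \<le> real n + real n"
      using E i p by (intro add_mono) (auto simp: E_def)
    finally have "c * nrm Y (L i v) \<le> 2 * n" by simp
    then have "nrm Y (L i v) \<le> 2 * n / c" using c by (simp add: field_simps)
    also have "\<dots> = (4 * n / R) * N" using R N by (simp add: c_def)
    finally show ?thesis by (simp add: N_def)
  qed
  then show ?thesis by blast
qed

section \<open>Riemann sums and independence of indices\<close>

text \<open>The intersection of the two partitions consists of degenerate intervals, whose terms vanish.\<close>

lemma tagged_division_sum_split:
  fixes f :: "real \<Rightarrow> 'a::real_vector"
  assumes p: "p tagged_division_of {a..c}" and q: "q tagged_division_of {c..b}" and "a \<le> c" "c \<le> b"
  shows "(p \<union> q) tagged_division_of {a..b}"
    and "(\<Sum>(s, k)\<in>p \<union> q. Henstock_Kurzweil_Integration.content k *\<^sub>R f s) =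
      (\<Sum>(s, k)\<in>p. Henstock_Kurzweil_Integration.content k *\<^sub>R f s) +
      (\<Sum>(s, k)\<in>q. Henstock_Kurzweil_Integration.content k *\<^sub>R f s)"
proof -
  have "interior {a..c} \<inter> interior {c..b} = {}" by auto
  then have "(p \<union> q) tagged_division_of ({a..c} \<union> {c..b})" using p q by (intro tagged_division_Un)
  moreover have "{a..c} \<union> {c..b} = {a..b}" using assms by auto
  ultimately show "(p \<union> q) tagged_division_of {a..b}" by simp
  have fin: "finite p" "finite q" using p q by auto
  have "Henstock_Kurzweil_Integration.content k = 0" if "(s, k) \<in> p \<inter> q" for s k
  proof -
    have "k \<subseteq> {a..c}" "k \<subseteq> {c..b}"
      using that tagged_division_ofD(3)[OF p, of s k] tagged_division_ofD(3)[OF q, of s k] by auto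
    then have "k \<subseteq> {c}" by (fastforce simp: subset_iff)
    then show ?thesis by (auto simp: subset_singleton_iff)
  qed
  then have "(\<Sum>(s, k)\<in>p \<inter> q. Henstock_Kurzweil_Integration.content k *\<^sub>R f s) = 0"
    by (intro sum.neutral) auto
  then show "(\<Sum>(s, k)\<in>p \<union> q. Henstock_Kurzweil_Integration.content k *\<^sub>R f s) =
      (\<Sum>(s, k)\<in>p. Henstock_Kurzweil_Integration.content k *\<^sub>R f s) +
      (\<Sum>(s, k)\<in>q. Henstock_Kurzweil_Integration.content k *\<^sub>R f s)"
    using sum.union_inter[OF fin, of "\<lambda>(s, k). Henstock_Kurzweil_Integration.content k *\<^sub>R f s"] by simp
qed

text \<open>Compatibility yields two moves: changing the target for a fixed source, and raising the
  source below a fixed target. Both members are brought to the common target \<open>max c d\<close>,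
  and the sources are compared there.\<close>

lemma scale_operator_index:
  assumes L: "scale_operator al au D Y L"
    and "al \<le> a" "a < c" "c \<le> au" "al \<le> b" "b < d" "d \<le> au" "y \<in> D a" "y \<in> D b"
  shows "L a c y = L b d y"
proof -
  have target: "L i j y = L i k y"
    if "al \<le> i" "i < j" "j \<le> au" "i < k" "k \<le> au" "y \<in> D i" for i j k
    using L that unfolding scale_operator_def by (metis linorder_less_linear)
  have source: "L i k y = L j k y"
    if "al \<le> i" "i < j" "j < k" "k \<le> au" "y \<in> D i" for i j k
    using L that unfolding scale_operator_def by metis
  define m where "m = max c d"
  have m: "a < m" "b < m" "m \<le> au" using assms by (auto simp: m_def)
  have "L a m y = L b m y"
    using source[of a b m] source[of b a m] assms m by (metis linorder_less_linear)
  then show ?thesis using target[of a c m] target[of b d m] assms m by simp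
qed


text \<open>The contents add up to b - a, so pointwise errors of at most e are averaged with that
  total weight. Valid for every tagged division, whatever its fineness, it takes the place of an
  estimate for an integral over [a, b].\<close>

lemma (in nspace) riemann_sum_near_const:
  assumes p: "p tagged_division_of {a..b}" and ab: "a \<le> b" and w: "w \<in> pts X"
    and f: "\<And>s. s \<in> {a..b} \<Longrightarrow> f s \<in> pts X" "\<And>s. s \<in> {a..b} \<Longrightarrow> nrm X (f s - w) \<le> e"
  shows "nrm X ((\<Sum>(s, k)\<in>p. Henstock_Kurzweil_Integration.content k *\<^sub>R f s) - (b - a) *\<^sub>R w)
    \<le> e * (b - a)"
proof -
  have tag: "s \<in> {a..b}" if "(s, k) \<in> p" for s k
    using tag_in_interval[OF p that] .
  have len: "(\<Sum>(s, k)\<in>p. Henstock_Kurzweil_Integration.content k) = b - a"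
    using additive_content_tagged_division[of p a b] p ab content_real[OF ab] unfolding box_real by simp
  have "(\<Sum>(s, k)\<in>p. Henstock_Kurzweil_Integration.content k *\<^sub>R w) = (b - a) *\<^sub>R w"
    unfolding len[symmetric] scaleR_sum_left by (simp add: case_prod_unfold)
  then have "(\<Sum>(s, k)\<in>p. Henstock_Kurzweil_Integration.content k *\<^sub>R f s) - (b - a) *\<^sub>R w
      = (\<Sum>(s, k)\<in>p. Henstock_Kurzweil_Integration.content k *\<^sub>R (f s - w))"
    by (simp only: case_prod_unfold scaleR_diff_right sum_subtractf)
  also have "nrm X \<dots> \<le> (\<Sum>i\<in>p. nrm X (case i of (s, k) \<Rightarrow>
      Henstock_Kurzweil_Integration.content k *\<^sub>R (f s - w)))"
  proof (rule nrm_sum, clarify)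
    fix s k assume "(s, k) \<in> p"
    then show "Henstock_Kurzweil_Integration.content k *\<^sub>R (f s - w) \<in> pts X"
      using f(1)[OF tag] w by simp
  qed
  also have "\<dots> \<le> (\<Sum>i\<in>p. case i of (s, k) \<Rightarrow> Henstock_Kurzweil_Integration.content k * e)"
  proof (intro sum_mono, clarify)
    fix s k assume "(s, k) \<in> p"
    then show "nrm X (Henstock_Kurzweil_Integration.content k *\<^sub>R (f s - w))
        \<le> Henstock_Kurzweil_Integration.content k * e"
      using f(1)[OF tag] f(2)[OF tag] w by (simp add: nrm_scale mult_left_mono)
  qed
  also have "\<dots> = (\<Sum>(s, k)\<in>p. Henstock_Kurzweil_Integration.content k) * e"
    by (simp add: sum_distrib_right case_prod_unfold)
  also have "\<dots> = e * (b - a)" by (simp add: len)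
  finally show ?thesis .
qed

lemma has_nintegralD:
  assumes "has_nintegral X f I a b" "\<epsilon> > 0"
  obtains \<delta> where "\<delta> > 0" "\<And>p. p tagged_division_of {a..b} \<Longrightarrow> (\<lambda>s. ball s \<delta>) fine p \<Longrightarrow>
    nrm X ((\<Sum>(s, k)\<in>p. Henstock_Kurzweil_Integration.content k *\<^sub>R f s) - I) < \<epsilon>"
proof -
  obtain \<delta> where \<delta>: "\<delta> > 0" "\<forall>p. p tagged_division_of {a..b} \<and> (\<lambda>s. ball s \<delta>) fine p \<longrightarrow>
      nrm X ((\<Sum>(s, k)\<in>p. Henstock_Kurzweil_Integration.content k *\<^sub>R f s) - I) < \<epsilon>"
    using assms(1)[unfolded has_nintegral_def, THEN conjunct2, THEN conjunct2, rule_format, OF assms(2)]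
    by (elim exE conjE)
  show thesis by (rule that[OF \<delta>(1)]) (simp add: \<delta>(2))
qed

lemma has_nintegral_cong:
  assumes "has_nintegral X f I a b" and eq: "\<And>s. s \<in> {a..b} \<Longrightarrow> f s = g s"
  shows "has_nintegral X g I a b"
proof -
  have sums: "(\<Sum>(s, k)\<in>p. Henstock_Kurzweil_Integration.content k *\<^sub>R g s) =
      (\<Sum>(s, k)\<in>p. Henstock_Kurzweil_Integration.content k *\<^sub>R f s)"
    if "p tagged_division_of {a..b}" for p
  proof (intro sum.cong refl, clarify)
    fix s k assume "(s, k) \<in> p"
    then show "Henstock_Kurzweil_Integration.content k *\<^sub>R g s = Henstock_Kurzweil_Integration.content k *\<^sub>R f s"
      using eq tag_in_interval[OF that] by metis
  qed
  show ?thesis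
    unfolding has_nintegral_def
  proof (intro conjI allI impI)
    show "I \<in> pts X" using assms(1) unfolding has_nintegral_def by (rule conjunct1)
    have "g ` {a..b} = f ` {a..b}" by (rule image_cong) (simp_all add: eq)
    also have "\<dots> \<subseteq> pts X" using assms(1) unfolding has_nintegral_def by blast
    finally show "g ` {a..b} \<subseteq> pts X" .
    fix \<epsilon> :: real assume "\<epsilon> > 0"
    from assms(1) this obtain \<delta> where \<delta>: "\<delta> > 0" and
      close: "\<And>p. p tagged_division_of {a..b} \<Longrightarrow> (\<lambda>s. ball s \<delta>) fine p \<Longrightarrow>
        nrm X ((\<Sum>(s, k)\<in>p. Henstock_Kurzweil_Integration.content k *\<^sub>R f s) - I) < \<epsilon>"
      by (rule has_nintegralD) blast
    show "\<exists>\<delta>>0. \<forall>p. p tagged_division_of {a..b} \<and> (\<lambda>s. ball s \<delta>) fine p \<longrightarrow>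
        nrm X ((\<Sum>(s, k)\<in>p. Henstock_Kurzweil_Integration.content k *\<^sub>R g s) - I) < \<epsilon>"
    proof (intro exI[of _ \<delta>] conjI allI impI \<delta>)
      fix p assume p: "p tagged_division_of {a..b} \<and> (\<lambda>s. ball s \<delta>) fine p"
      then show "nrm X ((\<Sum>(s, k)\<in>p. Henstock_Kurzweil_Integration.content k *\<^sub>R g s) - I) < \<epsilon>"
        unfolding sums[OF conjunct1[OF p]] by (intro close) simp_all
    qed
  qed
qed

section \<open>The integral equation and its operators in the scale\<close>

text \<open>\<open>lam_T\<close> is the form in which the lower bound on \<open>lam\<close> enters:
  all times below \<open>Tm au\<close> stay in [0, T), where the operators are defined.\<close>

locale integral_equation =
  fixes BB EE :: "real \<Rightarrow> 'a::real_vector nspace"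
    and U :: "real \<Rightarrow> real \<Rightarrow> real \<Rightarrow> real \<Rightarrow> 'a \<Rightarrow> 'a"
    and A B :: "real \<Rightarrow> real \<Rightarrow> real \<Rightarrow> 'a \<Rightarrow> 'a"
    and al au T \<beta> C1 \<alpha>0 lam :: real
    and r :: ereal
    and x :: 'a
    and u :: "real \<Rightarrow> 'a"
  assumes scale_BB: "banach_scale al au BB" and scale_EE: "banach_scale al au EE"
    and embedded: "scale_embedded al au BB EE"
    and x: "x \<in> pts (BB al)"
    and A1: "cond_A1 al au BB T U"
    and A2: "cond_A2 al au BB T U C1 \<beta>"
    and A4: "cond_A4 al au BB EE T U A"
    and B1: "cond_B1 al au BB T r x B"
    and al: "al < \<alpha>0" and au: "\<alpha>0 < au"
    and lam: "0 < lam" and lam_T: "(au - \<alpha>0) / lam < T"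
    and sol: "integral_solution al au BB r x U B \<alpha>0 lam u"
begin

abbreviation Tm :: "real \<Rightarrow> real" where
  "Tm \<alpha> \<equiv> (\<alpha> - \<alpha>0) / lam"

lemma Tm_less: "\<alpha> \<le> au \<Longrightarrow> t < Tm \<alpha> \<Longrightarrow> t < T"
  using divide_right_mono[of "\<alpha> - \<alpha>0" "au - \<alpha>0" lam] lam lam_T by linarith

lemma Tm_mono: "\<alpha> \<le> \<alpha>' \<Longrightarrow> t < Tm \<alpha> \<Longrightarrow> t < Tm \<alpha>'"
  using divide_right_mono[of "\<alpha> - \<alpha>0" "\<alpha>' - \<alpha>0" lam] lam by linarith

lemma Tm_pos: "0 \<le> t \<Longrightarrow> t < Tm \<alpha> \<Longrightarrow> \<alpha>0 < \<alpha>"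
  using lam by (smt (verit) divide_nonpos_pos)

lemma nspace_BB: "al \<le> \<alpha> \<Longrightarrow> \<alpha> \<le> au \<Longrightarrow> nspace (BB \<alpha>)"
  and banach_BB: "al \<le> \<alpha> \<Longrightarrow> \<alpha> \<le> au \<Longrightarrow> banach_space (BB \<alpha>)"
  and nspace_EE: "al \<le> \<alpha> \<Longrightarrow> \<alpha> \<le> au \<Longrightarrow> nspace (EE \<alpha>)"
  using scale_BB scale_EE by (auto simp: banach_scale_def banach_space_def nspace_def)

lemma BB_mono:
  assumes "al \<le> a" "a \<le> b" "b \<le> au" "v \<in> pts (BB a)"
  shows "v \<in> pts (BB b)"
  using assms scale_BB unfolding banach_scale_def
  by (metis order_le_less subsetD)

lemma BB_EE:
  assumes "al \<le> a" "a \<le> au" "v \<in> pts (BB a)"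
  shows "v \<in> pts (EE a)" "nrm (EE a) v \<le> nrm (BB a) v"
  using assms embedded unfolding scale_embedded_def by (auto simp: subset_iff)

lemma continuous_map_BB_EE:
  fixes f :: "real \<Rightarrow> 'a"
  assumes a: "al \<le> a" "a \<le> au" and f: "continuous_map (top_of_set S) (ntop (BB a)) f"
  shows "continuous_map (top_of_set S) (ntop (EE a)) f"
  unfolding nspace.continuous_map_ntop[OF nspace_EE[OF a]]
proof (intro ballI conjI allI impI)
  have p: "f t \<in> pts (BB a)" if "t \<in> S" for t
    using f that unfolding nspace.continuous_map_ntop[OF nspace_BB[OF a]] by blast
  fix t assume t: "t \<in> S"
  show "f t \<in> pts (EE a)" using BB_EE a p t by blast
  fix \<epsilon> :: real assume "\<epsilon> > 0"
  then obtain \<delta> where \<delta>: "\<delta> > 0" "\<And>s. s \<in> S \<Longrightarrow> dist s t < \<delta> \<Longrightarrow> nrm (BB a) (f s - f t) < \<epsilon>"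
    using f t unfolding nspace.continuous_map_ntop[OF nspace_BB[OF a]] by metis
  have "nrm (EE a) (f s - f t) < \<epsilon>" if "s \<in> S" "dist s t < \<delta>" for s
    using \<delta>(2)[OF that] BB_EE(2)[OF a, of "f s - f t"] p that t
      nspace.pts_arith(3)[OF nspace_BB[OF a]] by fastforce
  then show "\<exists>\<delta>>0. \<forall>s\<in>S. dist s t < \<delta> \<longrightarrow> nrm (EE a) (f s - f t) < \<epsilon>" using \<delta>(1) by blast
qed

lemma U_operator: "0 \<le> s \<Longrightarrow> s \<le> t \<Longrightarrow> t < T \<Longrightarrow> bounded_linear_operator al au BB BB (U t s)"
  using A1[unfolded cond_A1_def, THEN conjunct1] by simp

lemma A_operator: "0 \<le> t \<Longrightarrow> t < T \<Longrightarrow> bounded_linear_operator al au BB EE (A t)"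
  using A4[unfolded cond_A4_def, THEN conjunct1] by simp

lemma U_linear:
  "0 \<le> s \<Longrightarrow> s \<le> t \<Longrightarrow> t < T \<Longrightarrow> al \<le> a \<Longrightarrow> a < b \<Longrightarrow> b \<le> au \<Longrightarrow>
    bounded_linear_between (BB a) (BB b) (U t s a b)"
  using U_operator[of s t] by (simp add: bounded_linear_operator_def)

lemma A_linear:
  "0 \<le> t \<Longrightarrow> t < T \<Longrightarrow> al \<le> a \<Longrightarrow> a < b \<Longrightarrow> b \<le> au \<Longrightarrow>
    bounded_linear_between (BB a) (EE b) (A t a b)"
  using A_operator[of t] by (simp add: bounded_linear_operator_def)

lemma U_index:
  assumes "0 \<le> s" "s \<le> t" "t < T" "al \<le> a" "a < c" "c \<le> au" "al \<le> b" "b < d" "d \<le> au"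
    "y \<in> pts (BB a)" "y \<in> pts (BB b)"
  shows "U t s a c y = U t s b d y"
  by (rule scale_operator_index[OF U_operator[OF assms(1-3), unfolded bounded_linear_operator_def,
        THEN conjunct1] assms(4-11)])

lemma A_index:
  assumes "0 \<le> t" "t < T" "al \<le> a" "a < c" "c \<le> au" "al \<le> b" "b < d" "d \<le> au"
    "y \<in> pts (BB a)" "y \<in> pts (BB b)"
  shows "A t a c y = A t b d y"
  by (rule scale_operator_index[OF A_operator[OF assms(1,2), unfolded bounded_linear_operator_def,
        THEN conjunct1] assms(3-10)])

lemma U_bound:
  assumes "0 \<le> s" "s \<le> t" "t < T" "al \<le> a" "a < b" "b \<le> au" and v: "v \<in> pts (BB a)"
  shows "nrm (BB b) (U t s a b v) \<le> C1 / (b - a) powr \<beta> * nrm (BB a) v"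
proof -
  have n: "nspace (BB a)" "nspace (BB b)" using assms by (auto intro!: nspace_BB)
  have "nrm (BB b) (U t s a b v) \<le> opnorm (BB a) (BB b) (U t s a b) * nrm (BB a) v"
    using assms by (intro nrm_le_opnorm n U_linear) auto
  also have "\<dots> \<le> C1 / (b - a) powr \<beta> * nrm (BB a) v"
    using A2[unfolded cond_A2_def] assms nspace.nrm_nonneg[OF n(1) v] by (intro mult_right_mono) simp_all
  finally show ?thesis .
qed

lemma C1: "0 \<le> C1 / (b - a) powr \<beta>"
  using A2 unfolding cond_A2_def by simp

lemma U_cocycle:
  assumes "0 \<le> s" "s \<le> q" "q \<le> t" "t < T" "al \<le> a" "a < d" "d < b" "b \<le> au" "y \<in> pts (BB a)"
  shows "U t q d b (U q s a d y) = U t s a b y"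
proof -
  have "al \<le> a \<and> a < b \<and> b \<le> au" using assms by simp
  with A1[unfolded cond_A1_def, THEN conjunct2, THEN spec, THEN spec, THEN mp, of a b]
  show ?thesis using assms by simp
qed

lemma U_id:
  assumes "0 \<le> t" "t < T" "al \<le> a" "a < b" "b \<le> au" "y \<in> pts (BB a)"
  shows "U t t a b y = y"
  using A1[unfolded cond_A1_def, THEN conjunct2, THEN spec, THEN spec, THEN mp, of a b] assms by simp

lemma U_continuous:
  assumes "al \<le> a" "a < b" "b \<le> au" "y \<in> pts (BB a)"
  shows "continuous_map (top_of_set (time_triangle T)) (ntop (BB b)) (\<lambda>(t, s). U t s a b y)"
  using A1[unfolded cond_A1_def, THEN conjunct2, THEN spec, THEN spec, THEN mp, of a b] assms by simp

lemma A_continuous: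
  assumes "al \<le> a" "a < b" "b \<le> au" "y \<in> pts (BB a)"
  shows "continuous_map (top_of_set {0..<T}) (ntop (EE b)) (\<lambda>t. A t a b y)"
  using A4[unfolded cond_A4_def, THEN conjunct2, THEN conjunct2, THEN spec, THEN spec, THEN mp, of a b]
    assms by simp

lemma U_has_nderiv:
  assumes "al \<le> a" "a < c" "c < b" "b \<le> au" "y \<in> pts (BB a)" "0 \<le> s" "s \<le> t" "t < T"
  shows "has_nderiv (EE b) (\<lambda>h. U h s a b y) (A t c b (U t s a c y)) t {s..<T}"
  using A4[unfolded cond_A4_def, THEN conjunct2, THEN conjunct2, THEN spec, THEN spec, THEN mp, of a b]
    assms by simp

lemma u_ball: "\<alpha> \<le> au \<Longrightarrow> 0 \<le> t \<Longrightarrow> t < Tm \<alpha> \<Longrightarrow> u t \<in> sball BB r x \<alpha>"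
  using sol Tm_pos unfolding integral_solution_def by blast

lemma u_pts: "\<alpha> \<le> au \<Longrightarrow> 0 \<le> t \<Longrightarrow> t < Tm \<alpha> \<Longrightarrow> u t \<in> pts (BB \<alpha>)"
  using u_ball unfolding sball_def by blast

lemma u_continuous:
  "\<alpha>0 < \<alpha> \<Longrightarrow> \<alpha> \<le> au \<Longrightarrow> continuous_map (top_of_set {0..<Tm \<alpha>}) (ntop (BB \<alpha>)) u"
  using sol unfolding integral_solution_def by blast

lemma B_scale: "0 \<le> t \<Longrightarrow> t < T \<Longrightarrow> scale_operator al au (sball BB r x) BB (B t)"
  using B1 unfolding cond_B1_def nonlinear_operator_def by blast

lemma Bu_pts: "0 \<le> t \<Longrightarrow> t < Tm a \<Longrightarrow> a < b \<Longrightarrow> b \<le> au \<Longrightarrow> B t a b (u t) \<in> pts (BB b)"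
  using B_scale[of t] Tm_less[of a t] Tm_pos[of t a] u_ball[of a t] al
  unfolding scale_operator_def by (simp add: image_subset_iff)

lemma Bu_index:
  assumes "0 \<le> t" "t < Tm a" "a < c" "c \<le> au" "t < Tm b" "b < d" "d \<le> au"
  shows "B t a c (u t) = B t b d (u t)"
  using scale_operator_index[OF B_scale, of t a c b d "u t"] assms Tm_less[of a t] Tm_pos[of t a]
    Tm_pos[of t b] u_ball[of a t] u_ball[of b t] al by simp

text \<open>Joint continuity in B1 is composed with s -> (u(s), s), whose first component stays in
  the ball of \<open>BB a\<close> before \<open>Tm a\<close>.\<close>

lemma Bu_continuous:
  assumes "\<alpha>0 < a" "a < b" "b \<le> au"
  shows "continuous_map (top_of_set {0..<Tm a}) (ntop (BB b)) (\<lambda>s. B s a b (u s))"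
proof -
  have "continuous_map (top_of_set {0..<Tm a}) (subtopology (ntop (BB a)) (sball BB r x a)) u"
    using u_continuous[of a] assms u_ball[of a] by (auto simp: continuous_map_in_subtopology)
  moreover have "continuous_map (top_of_set {0..<Tm a}) (top_of_set {0..<T}) (\<lambda>s. s)"
    using Tm_less[of a] assms by (auto simp: continuous_map_in_subtopology)
  ultimately have "continuous_map (top_of_set {0..<Tm a})
      (prod_topology (subtopology (ntop (BB a)) (sball BB r x a)) (top_of_set {0..<T})) (\<lambda>s. (u s, s))"
    by (intro continuous_map_pairedI)
  moreover have "continuous_map
      (prod_topology (subtopology (ntop (BB a)) (sball BB r x a)) (top_of_set {0..<T}))
      (ntop (BB b)) (\<lambda>(v, t). B t a b v)"
    using B1 assms al unfolding cond_B1_def by simp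
  ultimately have "continuous_map (top_of_set {0..<Tm a}) (ntop (BB b))
      ((\<lambda>(v, t). B t a b v) \<circ> (\<lambda>s. (u s, s)))"
    by (rule continuous_map_compose)
  then show ?thesis by (simp add: comp_def)
qed

section \<open>Increments of the solution\<close>

text \<open>A solution comes with some pair of indices for each time separately. Comparing two times
  requires the same B(u(s),s), between the same indices, in both integrals; compatibility of
  \<open>B\<close> and \<open>U\<close> allows every admissible choice.\<close>

lemma integral_equation_at:
  assumes ab: "a < b" "b < c" "c \<le> au" and t: "0 \<le> t" "t < Tm a"
  obtains I where "has_nintegral (BB c) (\<lambda>s. U t s b c (B s a b (u s))) I 0 t"
    "u t = U t 0 al c x + I"
proof -
  have a: "\<alpha>0 < a" using Tm_pos t by blast
  have "\<exists>a' b' I. \<alpha>0 \<le> a' \<and> a' < b' \<and> b' < c \<and> t < Tm a' \<and>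
      has_nintegral (BB c) (\<lambda>s. U t s b' c (B s a' b' (u s))) I 0 t \<and> u t = U t 0 al c x + I"
    using sol a ab t Tm_mono[of a c t] unfolding integral_solution_def by auto
  then obtain a' b' I where *: "a' < b'" "b' < c" "t < Tm a'"
    "has_nintegral (BB c) (\<lambda>s. U t s b' c (B s a' b' (u s))) I 0 t" "u t = U t 0 al c x + I"
    by blast
  have a': "\<alpha>0 < a'" using Tm_pos t(1) *(3) by blast
  have "has_nintegral (BB c) (\<lambda>s. U t s b c (B s a b (u s))) I 0 t"
  proof (rule has_nintegral_cong[OF *(4)])
    fix s assume s: "s \<in> {0..t}"
    have eq: "B s a' b' (u s) = B s a b (u s)"
      using s t * ab by (intro Bu_index) auto
    moreover have "B s a' b' (u s) \<in> pts (BB b')" "B s a b (u s) \<in> pts (BB b)"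
      using s t * ab by (auto intro!: Bu_pts)
    ultimately show "U t s b' c (B s a' b' (u s)) = U t s b c (B s a b (u s))"
      using s t * ab a a' al Tm_less[of a t] by (auto intro!: U_index)
  qed
  then show thesis using that *(5) by blast
qed

text \<open>Over the degenerate interval \<open>I\<close> is determined through Riemann sums alone.
  All cells lie in {0} and have content 0, so \<open>I = 0\<close>, and U(0,0) is the
  embedding.\<close>

lemma u_0: "u 0 = x"
proof -
  define a where "a = (\<alpha>0 + au) / 2"
  define b where "b = (a + au) / 2"
  have ab: "\<alpha>0 < a" "a < b" "b < au" using au by (auto simp: a_def b_def)
  interpret nspace "BB au" using al au by (intro nspace_BB) auto
  have "0 < Tm a" using ab lam by simp
  then obtain I where I: "has_nintegral (BB au) (\<lambda>s. U 0 s b au (B s a b (u s))) I 0 0"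
    and u: "u 0 = U 0 0 al au x + I"
    using integral_equation_at[of a b au 0] ab by auto
  have Ip: "I \<in> pts (BB au)" using I by (simp add: has_nintegral_def)
  have "nrm (BB au) I \<le> 0"
  proof (rule field_le_epsilon)
    fix \<epsilon> :: real assume "\<epsilon> > 0"
    then obtain \<delta> where \<delta>: "\<delta> > 0" "\<And>p. p tagged_division_of {0..0} \<Longrightarrow> (\<lambda>s. ball s \<delta>) fine p \<Longrightarrow>
        nrm (BB au) ((\<Sum>(s, k)\<in>p. Henstock_Kurzweil_Integration.content k *\<^sub>R U 0 s b au (B s a b (u s))) - I) < \<epsilon>"
      using I unfolding has_nintegral_def by meson
    obtain p where p: "p tagged_division_of {0..0::real}" "(\<lambda>s. ball s \<delta>) fine p"
      using fine_division_exists_real[of "\<lambda>s. ball s \<delta>" 0 0] \<delta> gauge_ball by metis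
    have "Henstock_Kurzweil_Integration.content k = 0" if "(s, k) \<in> p" for s k
      using tagged_division_ofD(3)[OF p(1) that] by (auto simp: subset_singleton_iff)
    then have "(\<Sum>(s, k)\<in>p. Henstock_Kurzweil_Integration.content k *\<^sub>R U 0 s b au (B s a b (u s))) = 0"
      by (intro sum.neutral) auto
    then show "nrm (BB au) I \<le> 0 + \<epsilon>"
      using \<delta>(2)[OF p] Ip nrm_commute[of 0 I] by simp
  qed
  then have "I = 0" using nrm_nonneg[OF Ip] nrm_eq_0[OF Ip] by simp
  then show ?thesis using u U_id[of 0 al au x] x al au Tm_less[of a 0] \<open>0 < Tm a\<close> ab by simp
qed

text \<open>The increment is \<open>\<integral>\<^sub>p\<^sup>q U(q,s) B(u(s),s) ds\<close>: by the cocycle property, \<open>U(q,p)\<close> maps Riemann sums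
  of the equation at time \<open>p\<close> to partial Riemann sums of the equation at time \<open>q\<close>.\<close>

lemma increment:
  assumes ab: "a < b" "b < c" "c < d" "d \<le> au" and pq: "0 \<le> p" "p \<le> q" "q < Tm a"
    and w: "w \<in> pts (BB d)"
    and near: "\<And>s. s \<in> {p..q} \<Longrightarrow> nrm (BB d) (U q s b d (B s a b (u s)) - w) \<le> e"
  shows "nrm (BB d) (u q - U q p c d (u p) - (q - p) *\<^sub>R w) \<le> e * (q - p)"
proof (rule field_le_epsilon)
  have a: "\<alpha>0 < a" "al < a" using Tm_pos[of q a] pq al by auto
  have T: "q < T" "p < T" "p < Tm a" "p < Tm c" using Tm_less[of a q] Tm_mono[of a c p] pq ab by auto
  interpret D: nspace "BB d" using a ab by (intro nspace_BB) auto
  interpret C: nspace "BB c" using a ab by (intro nspace_BB) auto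
  fix \<epsilon> :: real assume \<epsilon>: "\<epsilon> > 0"
  define f where "f = (\<lambda>s. B s a b (u s))"
  define R where "R = (\<lambda>(P :: (real \<times> real set) set) h. \<Sum>(s, k)\<in>P. Henstock_Kurzweil_Integration.content k *\<^sub>R (h s :: 'a))"
  \<comment> \<open>Bound from A2 for \<open>U q p c d\<close>, which transports the Riemann error
    of the equation at p.\<close>
  define M where "M = C1 / (d - c) powr \<beta>"
  have M: "M \<ge> 0" unfolding M_def by (rule C1)
  have fp: "f s \<in> pts (BB b)" if "s \<in> {0..q}" for s
    using that pq ab by (auto simp: f_def intro!: Bu_pts)
  have Uf: "U q s b d (f s) \<in> pts (BB d)" if "s \<in> {0..q}" for s
    using bounded_linear_betweenD(1)[OF U_linear[of s q b d] fp[OF that] fp[OF that]] that T pq ab a by auto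
  have Ufc: "U p s b c (f s) \<in> pts (BB c)" if "s \<in> {0..p}" for s
    using bounded_linear_betweenD(1)[OF U_linear[of s p b c] fp fp, of s s] that T pq ab a by auto
  obtain I where I: "has_nintegral (BB d) (\<lambda>s. U q s b d (f s)) I 0 q" "u q = U q 0 al d x + I"
    unfolding f_def by (rule integral_equation_at[of a b d q]) (use ab pq in auto)
  \<comment> \<open>At time p the equation is read in \<open>BB c\<close>, below \<open>d\<close>,
    so that \<open>U q p c d\<close> can be applied to it.\<close>
  obtain J where J: "has_nintegral (BB c) (\<lambda>s. U p s b c (f s)) J 0 p" "u p = U p 0 al c x + J"
    unfolding f_def by (rule integral_equation_at[of a b c p]) (use ab pq in auto)
  have Ip: "I \<in> pts (BB d)" and Jp: "J \<in> pts (BB c)" using I J by (auto simp: has_nintegral_def)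
  \<comment> \<open>The error at p gets multiplied by \<open>M\<close>; dividing by
    \<open>M + 1\<close> leaves at most \<epsilon>/2 and is safe when \<open>M = 0\<close>.\<close>
  have "\<epsilon> / 2 > 0" "\<epsilon> / (2 * (M + 1)) > 0" using \<epsilon> M by auto
  note eps = this
  obtain \<delta>1 where \<delta>1: "\<delta>1 > 0"
    "\<And>P. P tagged_division_of {0..q} \<Longrightarrow> (\<lambda>s. ball s \<delta>1) fine P \<Longrightarrow>
      nrm (BB d) (R P (\<lambda>s. U q s b d (f s)) - I) < \<epsilon> / 2"
    using has_nintegralD[OF I(1) eps(1)] unfolding R_def by blast
  obtain \<delta>2 where \<delta>2: "\<delta>2 > 0"
    "\<And>P. P tagged_division_of {0..p} \<Longrightarrow> (\<lambda>s. ball s \<delta>2) fine P \<Longrightarrow>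
      nrm (BB c) (R P (\<lambda>s. U p s b c (f s)) - J) < \<epsilon> / (2 * (M + 1))"
    using has_nintegralD[OF J(1) eps(2)] unfolding R_def by blast
  \<comment> \<open>One radius for both integrals: the division of [0, p] serves at time p and,
    joined to one of [p, q], at time q.\<close>
  define \<delta> where "\<delta> = min \<delta>1 \<delta>2"
  have fineI: "(\<lambda>s. ball s \<delta>1) fine P \<and> (\<lambda>s. ball s \<delta>2) fine P" if "(\<lambda>s. ball s \<delta>) fine P" for P
    using that unfolding fine_def \<delta>_def by fastforce
  have "\<delta> > 0" using \<delta>1 \<delta>2 by (simp add: \<delta>_def)
  then have g: "gauge (\<lambda>s. ball s \<delta>)" by (rule gauge_ball)
  obtain P where P: "P tagged_division_of {0..p}" "(\<lambda>s. ball s \<delta>) fine P"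
    by (rule fine_division_exists_real[OF g])
  obtain Q where Q: "Q tagged_division_of {p..q}" "(\<lambda>s. ball s \<delta>) fine Q"
    by (rule fine_division_exists_real[OF g])
  note tagP = tag_in_interval[OF P(1)] and tagQ = tag_in_interval[OF Q(1)]
  define S where "S = R P (\<lambda>s. U p s b c (f s))"
  define P' where "P' = R P (\<lambda>s. U q s b d (f s))"
  define Q' where "Q' = R Q (\<lambda>s. U q s b d (f s))"
  have Sp: "S \<in> pts (BB c)"
    unfolding S_def R_def using tagP Ufc by (intro C.pts_sum) auto
  have P'p: "P' \<in> pts (BB d)"
    unfolding P'_def R_def using tagP Uf pq by (intro D.pts_sum) fastforce
  have Q'p: "Q' \<in> pts (BB d)"
    unfolding Q'_def R_def using tagQ Uf pq by (intro D.pts_sum) fastforce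
  have lin: "bounded_linear_between (BB c) (BB d) (U q p c d)"
    using pq T ab a by (intro U_linear) auto
  have "U q p c d S = R P (\<lambda>s. U q p c d (U p s b c (f s)))"
    unfolding S_def R_def case_prod_unfold using tagP Ufc
    by (intro bounded_linear_between_sum[OF C.nspace_axioms lin]) auto
  also have "\<dots> = P'"
    unfolding R_def P'_def
    by (intro sum.cong refl) (use tagP pq T ab a in \<open>force intro!: U_cocycle fp\<close>)
  finally have US: "U q p c d S = P'" .
  have Ux: "U p 0 al c x \<in> pts (BB c)"
    using bounded_linear_betweenD(1)[OF U_linear[of 0 p al c] x x] pq T ab a by auto
  have up: "U q p c d (u p) = U q 0 al d x + U q p c d J"
    unfolding J(2) using bounded_linear_betweenD(2)[OF lin Ux Jp] U_cocycle[of 0 p q al c d x] x pq T ab a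
    by simp
  have UJ: "U q p c d (S - J) = P' - U q p c d J"
    using bounded_linear_between_diff[OF C.nspace_axioms lin Sp Jp] US by simp
  have UJp: "U q p c d (S - J) \<in> pts (BB d)"
    using bounded_linear_betweenD(1)[OF lin, of "S - J" 0] Sp Jp by simp
  \<comment> \<open>The contributions of x cancel. What remains is the Riemann error at q, the
    transported Riemann error at p, and the deviation of the sum over [p, q] from (q - p) w. The
    first two are absorbed by \<epsilon>; the last gives e (q - p).\<close>
  have split: "u q - U q p c d (u p) - (q - p) *\<^sub>R w
      = (I - (P' + Q')) + (U q p c d (S - J) + (Q' - (q - p) *\<^sub>R w))"
    unfolding up UJ I(2) by simp
  have PQ: "P' + Q' = R (P \<union> Q) (\<lambda>s. U q s b d (f s))"
    unfolding P'_def Q'_def R_def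
    by (rule tagged_division_sum_split(2)[symmetric, OF P(1) Q(1)]) (use pq in auto)
  have "nrm (BB d) (P' + Q' - I) < \<epsilon> / 2"
    unfolding PQ using tagged_division_sum_split(1)[OF P(1) Q(1)] pq fineI[OF fine_Un[OF P(2) Q(2)]]
    by (intro \<delta>1(2)) auto
  then have 1: "nrm (BB d) (I - (P' + Q')) < \<epsilon> / 2"
    using D.nrm_commute[of I "P' + Q'"] Ip P'p Q'p by simp
  have "nrm (BB d) (U q p c d (S - J)) \<le> M * nrm (BB c) (S - J)"
    unfolding M_def using pq T ab a Sp Jp by (intro U_bound) auto
  also have "\<dots> \<le> M * (\<epsilon> / (2 * (M + 1)))"
    using \<delta>2(2)[OF P(1)] fineI[OF P(2)] M by (intro mult_left_mono) (auto simp: S_def)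
  also have "\<dots> \<le> \<epsilon> / 2" using M \<epsilon> by (simp add: field_simps)
  finally have 2: "nrm (BB d) (U q p c d (S - J)) \<le> \<epsilon> / 2" .
  have 3: "nrm (BB d) (Q' - (q - p) *\<^sub>R w) \<le> e * (q - p)"
    unfolding Q'_def R_def using pq w Uf near
    by (intro D.riemann_sum_near_const[OF Q(1)]) (auto simp: f_def)
  have "nrm (BB d) (u q - U q p c d (u p) - (q - p) *\<^sub>R w)
      \<le> nrm (BB d) (I - (P' + Q')) + nrm (BB d) (U q p c d (S - J) + (Q' - (q - p) *\<^sub>R w))"
    unfolding split using Ip P'p Q'p UJp w by (intro D.nrm_add) auto
  also have "nrm (BB d) (U q p c d (S - J) + (Q' - (q - p) *\<^sub>R w))
      \<le> nrm (BB d) (U q p c d (S - J)) + nrm (BB d) (Q' - (q - p) *\<^sub>R w)"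
    using Q'p UJp w by (intro D.nrm_add) auto
  finally show "nrm (BB d) (u q - U q p c d (u p) - (q - p) *\<^sub>R w) \<le> e * (q - p) + \<epsilon>"
    using 1 2 3 by linarith
qed

text \<open>Take w = B(u(t),t). The bound on U(q,s), uniform in q and s, allows B(u(s),s) to be
  replaced by w, and U(q,s) w tends to w as (q,s) tends to (t,t) by strong continuity in both
  times.\<close>

lemma increment_right:
  assumes ab: "a < b" "b < c" "c < d" "d \<le> au" and t: "0 \<le> t" "t < Tm a" and \<epsilon>: "\<epsilon> > 0"
  shows "\<exists>\<delta>>0. \<forall>q\<in>{t..<Tm a}. q - t < \<delta> \<longrightarrow>
    nrm (BB d) (u q - U q t c d (u t) - (q - t) *\<^sub>R B t a b (u t)) \<le> \<epsilon> * (q - t)"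
proof -
  have a: "\<alpha>0 < a" "al < a" using Tm_pos[of t a] t al by auto
  interpret D: nspace "BB d" using a ab by (intro nspace_BB) auto
  interpret B: nspace "BB b" using a ab by (intro nspace_BB) auto
  define y where "y = B t a b (u t)"
  have y: "y \<in> pts (BB b)" unfolding y_def using t ab by (intro Bu_pts) auto
  have yd: "y \<in> pts (BB d)" using BB_mono[of b d y] y ab a by auto
  define M where "M = C1 / (d - b) powr \<beta>"
  have M: "M \<ge> 0" unfolding M_def by (rule C1)
  have "continuous_map (top_of_set (time_triangle T)) (ntop (BB d)) (\<lambda>(t, s). U t s b d y)"
    using ab a y by (intro U_continuous) auto
  moreover have "(t, t) \<in> time_triangle T" using t Tm_less[of a t] ab by auto
  moreover have Utt: "U t t b d y = y" using U_id[of t b d y] y t Tm_less[of a t] ab a by auto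
  ultimately obtain \<delta>1 where \<delta>1: "\<delta>1 > 0"
    "\<And>z. z \<in> time_triangle T \<Longrightarrow> dist z (t, t) < \<delta>1 \<Longrightarrow> nrm (BB d) ((case z of (t, s) \<Rightarrow> U t s b d y) - y) < \<epsilon> / 2"
    using \<epsilon> unfolding D.continuous_map_ntop by (metis (no_types, lifting) case_prod_conv half_gt_zero)
  have "continuous_map (top_of_set {0..<Tm a}) (ntop (BB b)) (\<lambda>s. B s a b (u s))"
    using a ab by (intro Bu_continuous) auto
  moreover have "\<epsilon> / (2 * (M + 1)) > 0" using \<epsilon> M by auto
  moreover have "t \<in> {0..<Tm a}" using t by simp
  ultimately obtain \<delta>2 where \<delta>2: "\<delta>2 > 0"
    "\<And>s. s \<in> {0..<Tm a} \<Longrightarrow> dist s t < \<delta>2 \<Longrightarrow> nrm (BB b) (B s a b (u s) - y) < \<epsilon> / (2 * (M + 1))"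
    unfolding B.continuous_map_ntop y_def by metis
  \<comment> \<open>Both q and s deviate from t, and the distance of (q, s) from (t, t) is at most
    the sum of the deviations; hence half of \<delta>1.\<close>
  define \<delta> where "\<delta> = min (\<delta>1 / 2) \<delta>2"
  have "nrm (BB d) (u q - U q t c d (u t) - (q - t) *\<^sub>R y) \<le> \<epsilon> * (q - t)"
    if q: "q \<in> {t..<Tm a}" "q - t < \<delta>" for q
  proof (rule increment[OF ab t(1)])
    fix s assume s: "s \<in> {t..q}"
    have sq: "0 \<le> s" "s \<le> q" "q < T" "s < Tm a" using s q t Tm_less[of a q] ab by auto
    have fs: "B s a b (u s) \<in> pts (BB b)" using sq ab by (intro Bu_pts) auto
    have lin: "bounded_linear_between (BB b) (BB d) (U q s b d)" using sq ab a by (intro U_linear) auto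
    have p: "U q s b d (B s a b (u s)) \<in> pts (BB d)" "U q s b d y \<in> pts (BB d)"
      using bounded_linear_betweenD(1)[OF lin] fs y by blast+
    have "nrm (BB d) (U q s b d (B s a b (u s)) - y)
        \<le> nrm (BB d) (U q s b d (B s a b (u s)) - U q s b d y) + nrm (BB d) (U q s b d y - y)"
      using p yd by (intro D.nrm_diff_triangle) auto
    also have "U q s b d (B s a b (u s)) - U q s b d y = U q s b d (B s a b (u s) - y)"
      using bounded_linear_between_diff[OF B.nspace_axioms lin fs y] by simp
    also have "nrm (BB d) \<dots> \<le> M * nrm (BB b) (B s a b (u s) - y)"
      unfolding M_def using sq ab a fs y by (intro U_bound) auto
    also have "\<dots> \<le> M * (\<epsilon> / (2 * (M + 1)))"
      using \<delta>2(2)[of s] s q sq M by (intro mult_left_mono) (auto simp: \<delta>_def dist_real_def)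
    also have "\<dots> \<le> \<epsilon> / 2" using M \<epsilon> by (simp add: field_simps)
    also have "nrm (BB d) (U q s b d y - y) \<le> \<epsilon> / 2"
    proof -
      have "dist (q, s) (t, t) \<le> \<bar>q - t\<bar> + \<bar>s - t\<bar>"
        unfolding dist_Pair_Pair dist_real_def using sqrt_sum_squares_le_sum_abs by simp
      also have "\<dots> < \<delta>1" using s q by (auto simp: \<delta>_def)
      finally show ?thesis using \<delta>1(2)[of "(q, s)"] sq by simp
    qed
    finally show "nrm (BB d) (U q s b d (B s a b (u s)) - y) \<le> \<epsilon>" by simp
  qed (use q yd in auto)
  moreover have "\<delta> > 0" using \<delta>1 \<delta>2 by (simp add: \<delta>_def)
  ultimately show ?thesis unfolding y_def by blast
qed

section \<open>The right derivative and its continuity in the scale \<open>EE\<close>\<close>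

abbreviation rhs :: "real \<Rightarrow> real \<Rightarrow> real \<Rightarrow> 'a" where
  "rhs a d t \<equiv> A t a d (u t) + B t a d (u t)"

text \<open>The difference u(q) - u(t) is that of u(q) and U(q,t) u(t), estimated in the stronger
  norm of \<open>BB d\<close>, plus U(q,t) u(t) - u(t), to which A4 applies.\<close>

lemma right_derivative:
  assumes ad: "a < d" "d \<le> au" and t: "0 \<le> t" "t < Tm a" and \<epsilon>: "\<epsilon> > 0"
  shows "\<exists>\<delta>>0. \<forall>q\<in>{t..<Tm a}. q - t < \<delta> \<longrightarrow>
    nrm (EE d) (u q - u t - (q - t) *\<^sub>R rhs a d t) \<le> \<epsilon> * (q - t)"
proof -
  have a: "\<alpha>0 < a" "al < a" using Tm_pos[of t a] t al by auto
  have T: "t < T" using Tm_less[of a t] t ad by auto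
  \<comment> \<open>\<open>increment_right\<close> needs two indices between \<open>a\<close> and
    \<open>d\<close>: one for the values of \<open>B\<close>, one for the space in which the
    equation at time t is read.\<close>
  define b where "b = (a + d) / 2"
  define c where "c = (b + d) / 2"
  have ab: "a < b" "b < c" "c < d" using ad by (auto simp: b_def c_def)
  interpret E: nspace "EE d" using a ad by (intro nspace_EE) auto
  interpret D: nspace "BB d" using a ad by (intro nspace_BB) auto
  have ua: "u t \<in> pts (BB a)" using ad t by (intro u_pts) auto
  then have uc: "u t \<in> pts (BB c)" using BB_mono[of a c "u t"] a ab ad by auto
  obtain \<delta>1 where \<delta>1: "\<delta>1 > 0" "\<And>q. q \<in> {t..<Tm a} \<Longrightarrow> q - t < \<delta>1 \<Longrightarrow>
    nrm (BB d) (u q - U q t c d (u t) - (q - t) *\<^sub>R B t a b (u t)) \<le> \<epsilon> / 2 * (q - t)"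
    using increment_right[of a b c d t "\<epsilon> / 2"] ab ad t \<epsilon> half_gt_zero by metis
  have Beq: "B t a b (u t) = B t a d (u t)" using ab ad t by (intro Bu_index) auto
  have Ueq: "U q t c d (u t) = U q t a d (u t)" if "q \<in> {t..<T}" for q
    using that t ua uc a ab ad by (intro U_index) auto
  \<comment> \<open>A4 places \<open>U t t a c\<close> inside \<open>A\<close>; at equal times it is
    the embedding and disappears.\<close>
  have "has_nderiv (EE d) (\<lambda>h. U h t a d (u t)) (A t c d (U t t a c (u t))) t {t..<T}"
    using ua t T a ab ad by (intro U_has_nderiv) auto
  also have "U t t a c (u t) = u t" using U_id[of t a c "u t"] ua t T a ab ad by auto
  also have "A t c d (u t) = A t a d (u t)" using ua uc t T a ab ad by (intro A_index) auto
  finally have der: "has_nderiv (EE d) (\<lambda>h. U h t a d (u t)) (A t a d (u t)) t {t..<T}" .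
  have Up: "U h t a d (u t) \<in> pts (BB d)" if "h \<in> {t..<T}" for h
    using bounded_linear_betweenD(1)[OF U_linear[of t h a d] ua ua] that t a ad by auto
  then have UpE: "U h t a d (u t) \<in> pts (EE d)" if "h \<in> {t..<T}" for h
    using BB_EE(1)[of d] that a ad by auto
  have "t \<in> {t..<T}" using T by simp
  have "A t a d (u t) \<in> pts (EE d) \<and> (\<forall>\<epsilon>>0. \<exists>\<delta>>0. \<forall>h\<in>{t..<T}. \<bar>h - t\<bar> < \<delta> \<longrightarrow>
      nrm (EE d) (U h t a d (u t) - U t t a d (u t) - (h - t) *\<^sub>R A t a d (u t)) \<le> \<epsilon> * \<bar>h - t\<bar>)"
    using E.has_nderiv_iff[of t "{t..<T}" "\<lambda>h. U h t a d (u t)" "A t a d (u t)"] der UpE T by simp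
  then
  have Ap: "A t a d (u t) \<in> pts (EE d)" and
    "\<exists>\<delta>>0. \<forall>h\<in>{t..<T}. \<bar>h - t\<bar> < \<delta> \<longrightarrow>
      nrm (EE d) (U h t a d (u t) - U t t a d (u t) - (h - t) *\<^sub>R A t a d (u t)) \<le> \<epsilon> / 2 * \<bar>h - t\<bar>"
    using half_gt_zero[OF \<epsilon>] by blast+
  then obtain \<delta>2 where \<delta>2: "\<delta>2 > 0" "\<And>h. h \<in> {t..<T} \<Longrightarrow> h - t < \<delta>2 \<Longrightarrow>
      nrm (EE d) (U h t a d (u t) - u t - (h - t) *\<^sub>R A t a d (u t)) \<le> \<epsilon> / 2 * (h - t)"
    using U_id[of t a d "u t"] ua t T a ad by auto
  have "nrm (EE d) (u q - u t - (q - t) *\<^sub>R rhs a d t) \<le> \<epsilon> * (q - t)"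
    if q: "q \<in> {t..<Tm a}" "q - t < min \<delta>1 \<delta>2" for q
  proof -
    have qT: "q \<in> {t..<T}" using q Tm_less[of a q] ad by auto
    have B: "B t a d (u t) \<in> pts (BB d)" using t ad by (intro Bu_pts) auto
    have uq: "u q \<in> pts (BB d)" using q t ad Tm_mono[of a d] by (intro u_pts) auto
    have ut: "u t \<in> pts (BB d)" using t ad Tm_mono[of a d] by (intro u_pts) auto
    note toE = BB_EE(1)[of d] and toEn = BB_EE(2)[of d]
    define v where "v = u q - U q t a d (u t) - (q - t) *\<^sub>R B t a d (u t)"
    have v: "v \<in> pts (BB d)" unfolding v_def using uq Up[OF qT] B by auto
    have "u q - u t - (q - t) *\<^sub>R rhs a d t = v + (U q t a d (u t) - u t - (q - t) *\<^sub>R A t a d (u t))"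
      by (simp add: v_def algebra_simps)
    also have "nrm (EE d) \<dots> \<le> nrm (EE d) v + nrm (EE d) (U q t a d (u t) - u t - (q - t) *\<^sub>R A t a d (u t))"
      using toE v UpE[OF qT] ut Ap a ad by (intro E.nrm_add) auto
    also have "nrm (EE d) v \<le> nrm (BB d) v" using toEn v a ad by auto
    also have "\<dots> \<le> \<epsilon> / 2 * (q - t)" using \<delta>1(2)[of q] q by (simp add: v_def Ueq[OF qT] Beq)
    also have "nrm (EE d) (U q t a d (u t) - u t - (q - t) *\<^sub>R A t a d (u t)) \<le> \<epsilon> / 2 * (q - t)"
      using \<delta>2(2)[OF qT] q by simp
    finally show ?thesis by simp
  qed
  then show ?thesis using \<delta>1(1) \<delta>2(1) by (intro exI[of _ "min \<delta>1 \<delta>2"]) auto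
qed

text \<open>For a fixed vector, strong continuity bounds the norms on the compact interval [0, t1];
  uniform boundedness makes the constant independent of the vector.\<close>

lemma A_uniform_bound:
  assumes ad: "al \<le> a" "a < d" "d \<le> au" and t1: "t1 < T"
  shows "\<exists>K. \<forall>t\<in>{0..t1}. \<forall>v\<in>pts (BB a). nrm (EE d) (A t a d v) \<le> K * nrm (BB a) v"
proof (rule uniform_boundedness_nspace)
  show "banach_space (BB a)" using ad by (intro banach_BB) auto
  show "nspace (EE d)" using ad by (intro nspace_EE) auto
  then interpret E: nspace "EE d" .
  show "bounded_linear_between (BB a) (EE d) (A t a d)" if "t \<in> {0..t1}" for t
    using that ad t1 by (intro A_linear) auto
  fix v assume v: "v \<in> pts (BB a)"
  have "continuous_map (top_of_set {0..<T}) (ntop (EE d)) (\<lambda>t. A t a d v)"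
    using v ad by (intro A_continuous)
  then have cont: "A t a d v \<in> pts (EE d) \<and> (\<forall>\<epsilon>>0. \<exists>\<delta>>0. \<forall>s\<in>{0..<T}. dist s t < \<delta> \<longrightarrow>
      nrm (EE d) (A s a d v - A t a d v) < \<epsilon>)" if "t \<in> {0..<T}" for t
    using that unfolding E.continuous_map_ntop by blast
  have "continuous_on {0..t1} (\<lambda>t. nrm (EE d) (A t a d v))"
    unfolding continuous_on_iff
  proof (intro ballI allI impI)
    fix t \<epsilon> :: real assume t: "t \<in> {0..t1}" and "0 < \<epsilon>"
    then obtain \<delta> where \<delta>: "\<delta> > 0" "\<And>s. s \<in> {0..<T} \<Longrightarrow> dist s t < \<delta> \<Longrightarrow>
        nrm (EE d) (A s a d v - A t a d v) < \<epsilon>"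
      using cont[of t] t1 by auto
    have "dist (nrm (EE d) (A s a d v)) (nrm (EE d) (A t a d v)) < \<epsilon>"
      if s: "s \<in> {0..t1}" "dist s t < \<delta>" for s
    proof -
      have p: "A s a d v \<in> pts (EE d)" "A t a d v \<in> pts (EE d)" using cont s t t1 by auto
      have "nrm (EE d) (A s a d v) \<le> nrm (EE d) (A s a d v - A t a d v) + nrm (EE d) (A t a d v)"
        "nrm (EE d) (A t a d v) \<le> nrm (EE d) (A t a d v - A s a d v) + nrm (EE d) (A s a d v)"
        using E.nrm_add[of "A s a d v - A t a d v" "A t a d v"]
          E.nrm_add[of "A t a d v - A s a d v" "A s a d v"] p by auto
      moreover have "nrm (EE d) (A t a d v - A s a d v) = nrm (EE d) (A s a d v - A t a d v)"
        using p by (intro E.nrm_commute) auto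
      moreover have "nrm (EE d) (A s a d v - A t a d v) < \<epsilon>" using \<delta>(2)[of s] s t1 by auto
      ultimately show ?thesis unfolding dist_real_def by linarith
    qed
    then show "\<exists>\<delta>>0. \<forall>s\<in>{0..t1}. dist s t < \<delta> \<longrightarrow>
        dist (nrm (EE d) (A s a d v)) (nrm (EE d) (A t a d v)) < \<epsilon>"
      using \<delta>(1) by blast
  qed
  then have "bounded ((\<lambda>t. nrm (EE d) (A t a d v)) ` {0..t1})"
    by (intro compact_imp_bounded compact_continuous_image) auto
  then show "\<exists>M. \<forall>t\<in>{0..t1}. nrm (EE d) (A t a d v) \<le> M"
    unfolding bounded_iff real_norm_def by (meson abs_le_D1 image_eqI)
qed

text \<open>A(s)u(s) - A(t)u(t) is A(s)(u(s) - u(t)) plus (A(s) - A(t))u(t). In the first term the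
  operator moves together with the vector, which calls for a bound uniform in s; the second is
  strong continuity at the fixed vector u(t).\<close>

lemma rhs_continuous:
  assumes ad: "\<alpha>0 < a" "a < d" "d \<le> au"
  shows "continuous_map (top_of_set {0..<Tm a}) (ntop (EE d)) (rhs a d)"
proof -
  have a: "al < a" using ad al by simp
  interpret E: nspace "EE d" using a ad by (intro nspace_EE) auto
  interpret X: nspace "BB a" using a ad by (intro nspace_BB) auto
  have B: "continuous_map (top_of_set {0..<Tm a}) (ntop (EE d)) (\<lambda>t. B t a d (u t))"
    using a ad by (intro continuous_map_BB_EE Bu_continuous) auto
  \<comment> \<open>Strict, so that the closed interval [0, \<open>Tm a\<close>] lies in [0, T) and
    the uniform bound applies to it.\<close>
  have TmT: "Tm a < T" using lam lam_T ad by (smt (verit) divide_strict_right_mono)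
  obtain K where K: "\<And>t v. t \<in> {0..Tm a} \<Longrightarrow> v \<in> pts (BB a) \<Longrightarrow>
      nrm (EE d) (A t a d v) \<le> K * nrm (BB a) v"
    using A_uniform_bound[of a d "Tm a"] a ad TmT by (meson less_imp_le)
  have Ap: "A t a d v \<in> pts (EE d)" if "t \<in> {0..<Tm a}" "v \<in> pts (BB a)" for t v
    using bounded_linear_betweenD(1)[OF A_linear[of t a d] that(2,2)] that TmT a ad by auto
  have up: "u t \<in> pts (BB a)" if "t \<in> {0..<Tm a}" for t
    using that ad by (intro u_pts) auto
  have Bp: "B t a d (u t) \<in> pts (EE d)" if "t \<in> {0..<Tm a}" for t
    using B that unfolding E.continuous_map_ntop by blast
  show ?thesis
    unfolding E.continuous_map_ntop
  proof (intro ballI conjI allI impI)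
    fix t assume t: "t \<in> {0..<Tm a}"
    show "rhs a d t \<in> pts (EE d)" using Ap[OF t up[OF t]] Bp[OF t] by auto
    fix \<epsilon> :: real assume \<epsilon>: "\<epsilon> > 0"
    define M where "M = \<bar>K\<bar> + 1"
    have M: "M > 0" "K \<le> M" by (auto simp: M_def)
    obtain \<delta>1 where \<delta>1: "\<delta>1 > 0" "\<And>s. s \<in> {0..<Tm a} \<Longrightarrow> dist s t < \<delta>1 \<Longrightarrow>
        nrm (EE d) (B s a d (u s) - B t a d (u t)) < \<epsilon> / 3"
      using E.continuous_map_ntopD[OF B t, of "\<epsilon> / 3"] \<epsilon> by auto
    have "\<epsilon> / (3 * M) > 0" "a \<le> au" using \<epsilon> M ad by auto
    then obtain \<delta>2 where \<delta>2: "\<delta>2 > 0" "\<And>s. s \<in> {0..<Tm a} \<Longrightarrow> dist s t < \<delta>2 \<Longrightarrow>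
        nrm (BB a) (u s - u t) < \<epsilon> / (3 * M)"
      using X.continuous_map_ntopD[OF u_continuous[OF ad(1)] t] by blast
    have A: "continuous_map (top_of_set {0..<T}) (ntop (EE d)) (\<lambda>s. A s a d (u t))"
      using up[OF t] a ad by (intro A_continuous) auto
    have "t \<in> {0..<T}" using t TmT by auto
    then obtain \<delta>3 where \<delta>3: "\<delta>3 > 0" "\<And>s. s \<in> {0..<T} \<Longrightarrow> dist s t < \<delta>3 \<Longrightarrow>
        nrm (EE d) (A s a d (u t) - A t a d (u t)) < \<epsilon> / 3"
      using E.continuous_map_ntopD[OF A, of t "\<epsilon> / 3"] \<epsilon> by auto
    have "nrm (EE d) (rhs a d s - rhs a d t) < \<epsilon>"
      if s: "s \<in> {0..<Tm a}" "dist s t < min \<delta>1 (min \<delta>2 \<delta>3)" for s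
    proof -
      have lin: "bounded_linear_between (BB a) (EE d) (A s a d)"
        using s TmT a ad by (intro A_linear) auto
      have "rhs a d s - rhs a d t = A s a d (u s - u t) +
          ((A s a d (u t) - A t a d (u t)) + (B s a d (u s) - B t a d (u t)))"
        using bounded_linear_between_diff[OF X.nspace_axioms lin up[OF s(1)] up[OF t]] by simp
      also have "nrm (EE d) \<dots> \<le> nrm (EE d) (A s a d (u s - u t)) +
          nrm (EE d) ((A s a d (u t) - A t a d (u t)) + (B s a d (u s) - B t a d (u t)))"
        using Ap Bp up s t by (intro E.nrm_add) auto
      also have "nrm (EE d) ((A s a d (u t) - A t a d (u t)) + (B s a d (u s) - B t a d (u t)))
          \<le> nrm (EE d) (A s a d (u t) - A t a d (u t)) + nrm (EE d) (B s a d (u s) - B t a d (u t))"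
        using Ap Bp up s t by (intro E.nrm_add) auto
      also have "nrm (EE d) (A s a d (u t) - A t a d (u t)) < \<epsilon> / 3"
        using \<delta>3(2)[of s] s TmT by auto
      also have "nrm (EE d) (B s a d (u s) - B t a d (u t)) < \<epsilon> / 3"
        using \<delta>1(2)[of s] s by auto
      also have "nrm (EE d) (A s a d (u s - u t)) \<le> K * nrm (BB a) (u s - u t)"
        using K[of s] s t up by auto
      also have "\<dots> \<le> M * (\<epsilon> / (3 * M))"
        using \<delta>2(2)[of s] s t up M X.nrm_nonneg[of "u s - u t"] by (intro mult_mono) auto
      also have "\<dots> = \<epsilon> / 3" using M by simp
      finally show ?thesis by simp
    qed
    then show "\<exists>\<delta>>0. \<forall>s\<in>{0..<Tm a}. dist s t < \<delta> \<longrightarrow> nrm (EE d) (rhs a d s - rhs a d t) < \<epsilon>"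
      using \<delta>1(1) \<delta>2(1) \<delta>3(1) by (intro exI[of _ "min \<delta>1 (min \<delta>2 \<delta>3)"]) auto
  qed
qed

lemma rhs_index:
  assumes "0 \<le> t" "t < Tm a" "t < Tm b" "a < d" "b < d" "d \<le> au"
  shows "rhs a d t = rhs b d t"
  using A_index[of t a d b d "u t"] Bu_index[of t a d b d] assms Tm_less[of a t] Tm_pos[of t a]
    Tm_pos[of t b] u_pts[of a t] u_pts[of b t] al by auto

section \<open>The classical solution\<close>

text \<open>The passage to a two-sided derivative needs one continuous function as right derivative
  on the whole interval. This fixes the source index \<open>a\<close> and with it the end point
  \<open>Tm a\<close>.\<close>

lemma u_has_nderiv:
  assumes ad: "a < d" "d \<le> au" and t: "0 \<le> t" "t < Tm a"
  shows "has_nderiv (EE d) u (rhs a d t) t {0..<Tm a}"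
proof -
  have a: "\<alpha>0 < a" "al < a" using Tm_pos[of t a] t al by auto
  interpret D: nspace "BB d" using a ad by (intro nspace_BB) auto
  interpret E: nspace "EE d" using a ad by (intro nspace_EE) auto
  have "continuous_map (top_of_set {0..<Tm d}) (ntop (EE d)) u"
    using a ad by (intro continuous_map_BB_EE u_continuous) auto
  then have cont: "continuous_map (top_of_set {0..<Tm a}) (ntop (EE d)) u"
    by (rule continuous_map_from_subtopology_mono) (use ad lam in \<open>auto simp: field_simps\<close>)
  show ?thesis
  proof (rule E.has_nderiv_if_right_deriv[OF cont rhs_continuous])
    fix s \<epsilon> :: real assume "s \<in> {0..<Tm a}" "0 < \<epsilon>"
    then show "\<exists>\<delta>>0. \<forall>q\<in>{s..<Tm a}. q - s < \<delta> \<longrightarrow>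
        nrm (EE d) (u q - u s - (q - s) *\<^sub>R rhs a d s) \<le> \<epsilon> * (q - s)"
      using ad by (intro right_derivative) auto
  qed (use a ad t in auto)
qed

theorem classical: "classical_solution au BB EE r x A B \<alpha>0 lam u"
  unfolding classical_solution_def
proof (intro conjI allI impI)
  show "u 0 = x" by (rule u_0)
next
  fix d assume "\<alpha>0 < d \<and> d \<le> au"
  then have d: "\<alpha>0 < d" "d \<le> au" by auto
  show "continuous_map (top_of_set {0..<Tm d}) (ntop (BB d)) u" using d by (rule u_continuous)
  show "u t \<in> sball BB r x d" if "0 \<le> t \<and> t < Tm d" for t using u_ball that d by blast
  interpret E: nspace "EE d" using al d by (intro nspace_EE) auto
  \<comment> \<open>\<open>\<alpha>0 + lam * t\<close> is the index whose \<open>Tm\<close> equals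
    t; its midpoint with \<open>d\<close> leaves room on both sides.\<close>
  define m where "m t = (\<alpha>0 + lam * t + d) / 2" for t
  have m: "m t < d" "t < Tm (m t)" "\<alpha>0 < m t" if "t \<in> {0..<Tm d}" for t
  proof -
    have "\<alpha>0 + lam * t < d" using that lam by (simp add: field_simps)
    then show "m t < d" "t < Tm (m t)" using lam by (auto simp: m_def field_simps)
    then show "\<alpha>0 < m t" using that Tm_pos[of t "m t"] by auto
  qed
  define u' where "u' t = rhs (m t) d t" for t
  have u'_eq: "u' t = rhs a d t" if "0 \<le> t" "t < Tm a" "a < d" for a t
    using rhs_index[of t "m t" a d] that m[of t] d Tm_mono[of a d t] by (auto simp: u'_def)
  show "\<exists>u'. continuous_map (top_of_set {0..<Tm d}) (ntop (EE d)) u' \<and>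
      (\<forall>t. 0 \<le> t \<and> t < Tm d \<longrightarrow> has_nderiv (EE d) u (u' t) t {0..<Tm d} \<and>
        (\<forall>\<alpha>'. \<alpha>0 < \<alpha>' \<and> \<alpha>' < d \<and> t < Tm \<alpha>' \<longrightarrow> u' t = rhs \<alpha>' d t))"
  proof (intro exI[of _ u'] conjI allI impI)
    show "continuous_map (top_of_set {0..<Tm d}) (ntop (EE d)) u'"
      unfolding E.continuous_map_ntop
    proof (intro ballI)
      fix t assume t: "t \<in> {0..<Tm d}"
      define a where "a = m t"
      have a: "a < d" "t < Tm a" "\<alpha>0 < a" using m[OF t] by (auto simp: a_def)
      have cont: "rhs a d t \<in> pts (EE d) \<and> (\<forall>\<epsilon>>0. \<exists>\<delta>>0. \<forall>s\<in>{0..<Tm a}. dist s t < \<delta> \<longrightarrow>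
          nrm (EE d) (rhs a d s - rhs a d t) < \<epsilon>)"
        using rhs_continuous[OF a(3,1) d(2)] a(2) t unfolding E.continuous_map_ntop by auto
      have "\<exists>\<delta>>0. \<forall>s\<in>{0..<Tm d}. dist s t < \<delta> \<longrightarrow> nrm (EE d) (u' s - u' t) < \<epsilon>" if \<epsilon>: "\<epsilon> > 0" for \<epsilon>
      proof -
        obtain \<delta> where \<delta>: "\<delta> > 0" "\<And>s. s \<in> {0..<Tm a} \<Longrightarrow> dist s t < \<delta> \<Longrightarrow>
            nrm (EE d) (rhs a d s - rhs a d t) < \<epsilon>" using cont \<epsilon> by metis
        \<comment> \<open>Within \<open>Tm a - t\<close> of t, times stay below \<open>Tm a\<close>,
          so \<open>u' s\<close> can be computed with the fixed index \<open>a\<close> instead of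
          \<open>m s\<close>.\<close>
        have "nrm (EE d) (u' s - u' t) < \<epsilon>" if "s \<in> {0..<Tm d}" "dist s t < min \<delta> (Tm a - t)" for s
          using \<delta>(2)[of s] that u'_eq[of s a] u'_eq[of t a] a t by (auto simp: dist_real_def)
        then show ?thesis using \<delta>(1) a by (intro exI[of _ "min \<delta> (Tm a - t)"]) auto
      qed
      then show "u' t \<in> pts (EE d) \<and> (\<forall>\<epsilon>>0. \<exists>\<delta>>0. \<forall>s\<in>{0..<Tm d}. dist s t < \<delta> \<longrightarrow>
          nrm (EE d) (u' s - u' t) < \<epsilon>)"
        using cont u'_eq[of t a] a t by auto
    qed
  next
    fix t assume "0 \<le> t \<and> t < Tm d"
    then have t: "t \<in> {0..<Tm d}" by auto
    define a where "a = m t"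
    have a: "a < d" "t < Tm a" "\<alpha>0 < a" using m[OF t] by (auto simp: a_def)
    have up: "u s \<in> pts (EE d)" if "s \<in> {0..<Tm d}" for s
      using BB_EE(1)[of d "u s"] u_pts[of d s] that al d by auto
    have upa: "u s \<in> pts (EE d)" if "s \<in> {0..<Tm a}" for s
      using up that Tm_mono[of a d s] a by auto
    have ta: "t \<in> {0..<Tm a}" using t a by auto
    have *: "rhs a d t \<in> pts (EE d) \<and> (\<forall>\<epsilon>>0. \<exists>\<delta>>0. \<forall>h\<in>{0..<Tm a}. \<bar>h - t\<bar> < \<delta> \<longrightarrow>
        nrm (EE d) (u h - u t - (h - t) *\<^sub>R rhs a d t) \<le> \<epsilon> * \<bar>h - t\<bar>)"
      using u_has_nderiv[of a d t] E.has_nderiv_iff[OF ta upa] a d t by auto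
    \<comment> \<open>Differentiability is local: near t the sets {0..<Tm a} and {0..<Tm d}
      agree.\<close>
    have "\<exists>\<delta>>0. \<forall>h\<in>{0..<Tm d}. \<bar>h - t\<bar> < \<delta> \<longrightarrow>
        nrm (EE d) (u h - u t - (h - t) *\<^sub>R rhs a d t) \<le> \<epsilon> * \<bar>h - t\<bar>" if \<epsilon>: "\<epsilon> > 0" for \<epsilon>
    proof -
      obtain \<delta> where \<delta>: "\<delta> > 0" "\<And>h. h \<in> {0..<Tm a} \<Longrightarrow> \<bar>h - t\<bar> < \<delta> \<Longrightarrow>
        nrm (EE d) (u h - u t - (h - t) *\<^sub>R rhs a d t) \<le> \<epsilon> * \<bar>h - t\<bar>" using * \<epsilon> by metis
      have "h \<in> {0..<Tm a}" if "h \<in> {0..<Tm d}" "\<bar>h - t\<bar> < Tm a - t" for h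
        using that by auto
      then show ?thesis using \<delta> a by (intro exI[of _ "min \<delta> (Tm a - t)"]) auto
    qed
    then show "has_nderiv (EE d) u (u' t) t {0..<Tm d}"
      using * E.has_nderiv_iff[OF t up] u'_eq[of t a] a t by auto
  next
    fix t \<alpha>' assume "0 \<le> t \<and> t < Tm d" "\<alpha>0 < \<alpha>' \<and> \<alpha>' < d \<and> t < Tm \<alpha>'"
    then show "u' t = rhs \<alpha>' d t" by (intro u'_eq) auto
  qed
qed

end

theorem theorem2p13:
  fixes BB EE :: "real \<Rightarrow> 'a::real_vector nspace"
    and U :: "real \<Rightarrow> real \<Rightarrow> real \<Rightarrow> real \<Rightarrow> 'a \<Rightarrow> 'a"
    and A B :: "real \<Rightarrow> real \<Rightarrow> real \<Rightarrow> 'a \<Rightarrow> 'a"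
    and al au T \<beta> C1 C2 C3 \<alpha>0 \<gamma> lam :: real
    and C :: "real \<Rightarrow> real"
    and r :: ereal
    and x :: 'a
    and u :: "real \<Rightarrow> 'a"
  assumes "banach_scale al au BB" and "banach_scale al au EE"
    and "scale_embedded al au BB EE"
    and "0 < T" and "x \<in> pts (BB al)"
    and "cond_A1 al au BB T U"
    and "cond_A2 al au BB T U C1 \<beta>"
    and "cond_A3 al au BB T U x C"
    and "cond_A4 al au BB EE T U A"
    and "cond_B1 al au BB T r x B"
    and "cond_B2 al au BB T r x B C2 \<beta>"
    and "cond_B3 al au BB T x B C3"
    and "(\<beta> = 0 \<and> 0 < r) \<or> (0 < \<beta> \<and> \<beta> < 1/2 \<and> r = \<infinity>)"
    and "al < \<alpha>0" and "\<alpha>0 < au"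
    and "\<beta> < \<gamma>" and "\<gamma> < 1 - \<beta>"
    and "lam > lambda0 al au C1 C2 C3 \<beta> (nrm (BB al) x) (C \<alpha>0) \<alpha>0 \<gamma> r T"
    and "integral_solution al au BB r x U B \<alpha>0 lam u"
    and "(SUP \<alpha>\<in>{\<alpha>0<..au}. SUP t\<in>{0..<(\<alpha> - \<alpha>0) / lam}.
            ereal ((\<alpha> - \<alpha>0 - lam * t) powr \<gamma> * nrm (BB \<alpha>) (u t))) < \<infinity>"
  shows "classical_solution au BB EE r x A B \<alpha>0 lam u"
proof -
  \<comment> \<open>The first of the four numbers under the maximum. Since
    \<open>al < \<alpha>0\<close>, it gives the bound required as \<open>lam_T\<close>.\<close>
  have "(au - al) / T < lam"
    using assms(18) unfolding lambda0_def Let_def by (subst (asm) Max_less_iff) auto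
  moreover have "0 < (au - al) / T" using assms(4,14,15) by simp
  ultimately have lam: "0 < lam" and "au - al < lam * T" using assms(4) by (linarith, simp add: field_simps)
  then have "(au - \<alpha>0) / lam < T" using assms(14) by (simp add: field_simps)
  with lam assms interpret integral_equation BB EE U A B al au T \<beta> C1 \<alpha>0 lam r x u
    by unfold_locales
  show ?thesis by (rule classical)
qed

end
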